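(* Consider decentralized algorithms belonging to the black-box class described in the context, applied to (non strongly) convex-concave saddle point problems $$\min_{x\in\mathcal{X}}\max_{y\in\mathcal{Y}} f(x,y):=\frac1M\sum_{m=1}^M f_m(x,y)$$ over time-varying networks that are connected at each moment and have condition number $\chi$, where $L$ is the smoothness constant of $f$, $D$ is the diameter of the convex sets $\mathcal{X}$ and $\mathcal{Y}$, and $\varepsilon$ is the precision of the solution. Using regularization, one considers the objective function $$f(x,y)+\frac{\varepsilon}{4D^2}\cdot\|x-x^0\|^2-\frac{\varepsilon}{4D^2}\cdot\|y-y^0\|^2,$$ which is strongly-convex-strongly-concave with constant $\mu=\frac{\varepsilon}{2D^2}$; the resulting new saddle point problem is solved to $\varepsilon/2$-precision in order to guarantee an accuracy $\varepsilon$ in computing the solution of the original problem. Therefore the lower bounds for the convex-concave case are $$\Omega\left(\chi\,\frac{LD^2}{\varepsilon}\right)\ \text{communication rounds}\quad\text{and}\quad\Omega\left(\frac{LD^2}{\varepsilon}\right)\ \text{local computations}.$$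
   Context: Norms are Euclidean, $\mathcal{Z}=\mathcal{X}\times\mathcal{Y}$, $z=(x,y)$, and $(x^0,y^0)$ is the starting point. Accuracy in this lower bound is in terms of the squared distance of the output to the solution. For a differentiable function $g(x,y)$ put $G(z)=(\nabla_x g(x,y),\,-\nabla_y g(x,y))$. The function $g$ is $L$-smooth if $\|G(z_1)-G(z_2)\|\le L\|z_1-z_2\|$ for all $z_1,z_2\in\mathcal{Z}$; strongly-convex-strongly-concave with constant $\mu$ if $\langle G(z_1)-G(z_2),z_1-z_2\rangle\ge\mu\|z_1-z_2\|^2$ for all $z_1,z_2\in\mathcal{Z}$; and convex-concave if the latter holds with $\mu=0$. Network. At each moment $t$ the devices $\mathcal{V}=\{1,\dots,M\}$ are connected by an undirected connected graph $\mathcal{G}(t)=(\mathcal{V},\mathcal{E}(t))$, where $(i,j)\in\mathcal{E}(t)$ iff there is a communication link between devices $i$ and $j$ at moment $t$. A gossip matrix $W(t)$ at moment $t$ is an $M\times M$ symmetric positive semi-definite matrix whose kernel is the set of constant vectors and such that $W_{ij}(t)\ne 0$ only if $i=j$ or $(i,j)\in\mathcal{E}(t)$. With eigenvalues $\lambda_1(W(t))\ge\dots\ge\lambda_M(W(t))=0$, the condition number is $\chi=\max_t\chi(W(t))=\max_t\lambda_1(W(t))/\lambda_{M-1}(W(t))$. Black-box class of algorithms. Only device $m$ knows $f_m$. Each device $m$ has its own local memories $\mathcal{M}_m^x$ and $\mathcal{M}_m^y$ for the $x$- and $y$-variables, respectively, with initialization $\mathcal{M}_m^x=\mathcal{M}_m^y=\{0\}$.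 They are updated as follows. (i) Local computation: each device $m$ computes and adds to its $\mathcal{M}_m^x$ and $\mathcal{M}_m^y$ a finite number of points $x,y$, each satisfying $x\in\mathrm{span}\{x',\nabla_x f_m(x'',y'')\}$, $y\in\mathrm{span}\{y',\nabla_y f_m(x'',y'')\}$ for given $x',x''\in\mathcal{M}_m^x$ and $y',y''\in\mathcal{M}_m^y$. (ii) Communication: based upon a communication round among neighbouring nodes at moment $t$, the memories are updated according to $\mathcal{M}_m^x:=\mathrm{span}\{\bigcup_{(i,m)\in\mathcal{E}(t)}\mathcal{M}_i^x\}$ and $\mathcal{M}_m^y:=\mathrm{span}\{\bigcup_{(i,m)\in\mathcal{E}(t)}\mathcal{M}_i^y\}$. (iii) Output: the final global output at the current moment is $z=(x,y)$ with $x\in\mathrm{span}\{\bigcup_{m=1}^M\mathcal{M}_m^x\}$ and $y\in\mathrm{span}\{\bigcup_{m=1}^M\mathcal{M}_m^y\}$.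
   Formalization: The guarantee that ε/2-precision on the regularized problem gives accuracy ε on the original is stated for the primal-dual gap, as it fails for squared distance; the Ω bounds (in squared distance) are for ε ≤ δD² and ε ≤ δLD² with a universal δ > 0. *)

theory Defs
  imports
    "HOL-Analysis.Analysis"
    "HOL-Library.Poly_Mapping"
    "Jordan_Normal_Form.Char_Poly"
    "Jordan_Normal_Form.Matrix_Kernel"
begin

section \<open>Euclidean spaces of varying dimension\<close>

text \<open>
  The dimension of the space is chosen inside the statement, so it cannot be a type. Finitely
  supported real sequences with the Euclidean inner product contain all the spaces
  \<open>\<real>^n\<close> as coordinate subspaces \<open>euclid n\<close>.
\<close>

instantiation poly_mapping :: (type, real_vector) real_vector
begin

definition scaleR_poly_mapping :: "real \<Rightarrow> ('a \<Rightarrow>\<^sub>0 'b) \<Rightarrow> 'a \<Rightarrow>\<^sub>0 'b"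
  where "scaleR_poly_mapping r p = Poly_Mapping.map (scaleR r) p"

lemma lookup_scaleR [simp]: "Poly_Mapping.lookup (r *\<^sub>R p) k = r *\<^sub>R Poly_Mapping.lookup p k"
  for p :: "'a \<Rightarrow>\<^sub>0 'b"
  by (simp add: scaleR_poly_mapping_def Poly_Mapping.map.rep_eq when_def)

instance
  by standard
    (auto intro!: poly_mapping_eqI
      simp: lookup_add scaleR_add_right scaleR_add_left)

end

instantiation poly_mapping :: (type, real_inner) real_inner
begin

definition inner_poly_mapping :: "('a \<Rightarrow>\<^sub>0 'b) \<Rightarrow> ('a \<Rightarrow>\<^sub>0 'b) \<Rightarrow> real"
  where "inner_poly_mapping p q =
    (\<Sum>k\<in>Poly_Mapping.keys p. inner (Poly_Mapping.lookup p k) (Poly_Mapping.lookup q k))"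

definition norm_poly_mapping :: "('a \<Rightarrow>\<^sub>0 'b) \<Rightarrow> real"
  where "norm_poly_mapping p = sqrt (inner p p)"

definition dist_poly_mapping :: "('a \<Rightarrow>\<^sub>0 'b) \<Rightarrow> ('a \<Rightarrow>\<^sub>0 'b) \<Rightarrow> real"
  where "dist_poly_mapping p q = norm (p - q)"

definition sgn_poly_mapping :: "('a \<Rightarrow>\<^sub>0 'b) \<Rightarrow> 'a \<Rightarrow>\<^sub>0 'b"
  where "sgn_poly_mapping p = inverse (norm p) *\<^sub>R p"

definition uniformity_poly_mapping :: "(('a \<Rightarrow>\<^sub>0 'b) \<times> ('a \<Rightarrow>\<^sub>0 'b)) filter"
  where "uniformity_poly_mapping = (INF e\<in>{0<..}. principal {(p, q). dist p q < e})"

definition open_poly_mapping :: "('a \<Rightarrow>\<^sub>0 'b) set \<Rightarrow> bool"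
  where "open_poly_mapping U \<longleftrightarrow>
    (\<forall>p\<in>U. \<forall>\<^sub>F (p', q) in uniformity. p' = p \<longrightarrow> q \<in> U)"

lemma inner_poly_mapping_superset:
  "finite K \<Longrightarrow> Poly_Mapping.keys p \<subseteq> K \<Longrightarrow>
    inner p q = (\<Sum>k\<in>K. inner (Poly_Mapping.lookup p k) (Poly_Mapping.lookup q k))"
  for p q :: "'a \<Rightarrow>\<^sub>0 'b"
  unfolding inner_poly_mapping_def
  by (rule sum.mono_neutral_left) (auto simp: in_keys_iff)

instance
proof
  fix p q s :: "'a \<Rightarrow>\<^sub>0 'b" and r :: real
  define K where "K = Poly_Mapping.keys p \<union> Poly_Mapping.keys q \<union> Poly_Mapping.keys s"
  have fin: "finite K" by (simp add: K_def)
  have sub: "Poly_Mapping.keys p \<subseteq> K" "Poly_Mapping.keys q \<subseteq> K"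
    "Poly_Mapping.keys (p + q) \<subseteq> K" "Poly_Mapping.keys (r *\<^sub>R p) \<subseteq> K"
    by (auto simp: K_def in_keys_iff lookup_add)
  note eqs = inner_poly_mapping_superset [OF fin sub(1)]
    inner_poly_mapping_superset [OF fin sub(2)]
    inner_poly_mapping_superset [OF fin sub(3)]
    inner_poly_mapping_superset [OF fin sub(4)]
  show "dist p q = norm (p - q)" by (rule dist_poly_mapping_def)
  show "sgn p = inverse (norm p) *\<^sub>R p" by (rule sgn_poly_mapping_def)
  show "uniformity = (INF e\<in>{0<..}. principal {(p, q :: 'a \<Rightarrow>\<^sub>0 'b). dist p q < e})"
    by (rule uniformity_poly_mapping_def)
  show "open U \<longleftrightarrow> (\<forall>p\<in>U. \<forall>\<^sub>F (p', q) in uniformity. p' = p \<longrightarrow> q \<in> U)"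
    for U :: "('a \<Rightarrow>\<^sub>0 'b) set"
    by (rule open_poly_mapping_def)
  show "norm p = sqrt (inner p p)" by (rule norm_poly_mapping_def)
  show "inner p q = inner q p" by (simp add: eqs inner_commute)
  show "inner (p + q) s = inner p s + inner q s"
    by (simp add: eqs lookup_add inner_add_left sum.distrib)
  show "inner (r *\<^sub>R p) q = r * inner p q" by (simp add: eqs sum_distrib_left)
  show "0 \<le> inner p p" by (simp add: inner_poly_mapping_def sum_nonneg)
  show "inner p p = 0 \<longleftrightarrow> p = 0"
    unfolding inner_poly_mapping_def
    by (subst sum_nonneg_eq_0_iff) (auto simp: in_keys_iff intro!: poly_mapping_eqI)
qed

end

type_synonym rvec = "nat \<Rightarrow>\<^sub>0 real"

definition euclid :: "nat \<Rightarrow> rvec set"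
  where "euclid n = {v. Poly_Mapping.keys v \<subseteq> {..<n}}"


section \<open>Saddle point problems\<close>

text \<open>
  A set \<open>S\<close> always denotes the ambient space \<open>\<real>^nx \<times> \<real>^ny\<close>. Values of an objective
  outside \<open>S\<close> play no role, so derivatives are taken within \<open>S\<close>. The set \<open>Z\<close> is the part of \<open>S\<close>
  on which an inequality is required. Black-box algorithms do not project, so they may query
  gradients anywhere in \<open>S\<close>, not only in \<open>X \<times> Y\<close>.
\<close>

type_synonym objective = "rvec \<times> rvec \<Rightarrow> real"

definition ambient :: "nat \<Rightarrow> nat \<Rightarrow> (rvec \<times> rvec) set"
  where "ambient nx ny = euclid nx \<times> euclid ny"

definition grad :: "(rvec \<times> rvec) set \<Rightarrow> objective \<Rightarrow> rvec \<times> rvec \<Rightarrow> rvec \<times> rvec"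
  where "grad S f z =
    (THE g. g \<in> S \<and> (f has_derivative (\<lambda>h. inner g h)) (at z within S))"

definition saddle_operator ::
    "(rvec \<times> rvec) set \<Rightarrow> objective \<Rightarrow> rvec \<times> rvec \<Rightarrow> rvec \<times> rvec"
  where "saddle_operator S f z = (fst (grad S f z), - snd (grad S f z))"

definition L_smooth ::
    "(rvec \<times> rvec) set \<Rightarrow> (rvec \<times> rvec) set \<Rightarrow> real \<Rightarrow> objective \<Rightarrow> bool"
  where "L_smooth S Z L f \<longleftrightarrow> f differentiable_on S \<and>
    (\<forall>z1\<in>Z. \<forall>z2\<in>Z.
      norm (saddle_operator S f z1 - saddle_operator S f z2) \<le> L * norm (z1 - z2))"

definition strongly_convex_concave ::
    "(rvec \<times> rvec) set \<Rightarrow> (rvec \<times> rvec) set \<Rightarrow> real \<Rightarrow> objective \<Rightarrow> bool"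
  where "strongly_convex_concave S Z \<mu> f \<longleftrightarrow> f differentiable_on S \<and>
    (\<forall>z1\<in>Z. \<forall>z2\<in>Z.
      inner (saddle_operator S f z1 - saddle_operator S f z2) (z1 - z2) \<ge> \<mu> * (norm (z1 - z2))\<^sup>2)"

abbreviation convex_concave ::
    "(rvec \<times> rvec) set \<Rightarrow> (rvec \<times> rvec) set \<Rightarrow> objective \<Rightarrow> bool"
  where "convex_concave S Z f \<equiv> strongly_convex_concave S Z 0 f"

definition convex_body :: "nat \<Rightarrow> real \<Rightarrow> rvec set \<Rightarrow> bool"
  where "convex_body n D X \<longleftrightarrow>
    X \<subseteq> euclid n \<and> X \<noteq> {} \<and> convex X \<and> bounded X \<and> diameter X = D"

definition saddle_point :: "rvec set \<Rightarrow> rvec set \<Rightarrow> objective \<Rightarrow> rvec \<times> rvec \<Rightarrow> bool"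
  where "saddle_point X Y f z \<longleftrightarrow> z \<in> X \<times> Y \<and>
    (\<forall>x\<in>X. \<forall>y\<in>Y. f (fst z, y) \<le> f z \<and> f z \<le> f (x, snd z))"

text \<open>
  The two notions of accuracy: squared distance to a solution, used in the lower bound, and the
  primal-dual gap \<open>max\<^sub>y' f(x, y') - min\<^sub>x' f(x', y)\<close>, for which the regularization
  argument holds.
\<close>

definition dist_accurate ::
    "rvec set \<Rightarrow> rvec set \<Rightarrow> objective \<Rightarrow> real \<Rightarrow> rvec \<times> rvec \<Rightarrow> bool"
  where "dist_accurate X Y f e z \<longleftrightarrow> (\<exists>zs. saddle_point X Y f zs \<and> (norm (z - zs))\<^sup>2 \<le> e)"

definition gap_accurate ::
    "rvec set \<Rightarrow> rvec set \<Rightarrow> objective \<Rightarrow> real \<Rightarrow> rvec \<times> rvec \<Rightarrow> bool"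
  where "gap_accurate X Y f e z \<longleftrightarrow> z \<in> X \<times> Y \<and>
    (\<forall>x'\<in>X. \<forall>y'\<in>Y. f (fst z, y') - f (x', snd z) \<le> e)"

definition regularized :: "real \<Rightarrow> real \<Rightarrow> rvec \<times> rvec \<Rightarrow> objective \<Rightarrow> objective"
  where "regularized \<epsilon> D z0 f = (\<lambda>(x, y). f (x, y)
    + \<epsilon> / (4 * D\<^sup>2) * (norm (x - fst z0))\<^sup>2 - \<epsilon> / (4 * D\<^sup>2) * (norm (y - snd z0))\<^sup>2)"

definition average :: "nat \<Rightarrow> (nat \<Rightarrow> objective) \<Rightarrow> objective"
  where "average M fs z = (\<Sum>m<M. fs m z) / real M"


section \<open>Time-varying networks\<close>

text \<open>The devices are numbered \<open>0, \<dots>, M - 1\<close>, as are the rows of a matrix.\<close>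

definition connected_graph :: "nat \<Rightarrow> (nat \<times> nat) set \<Rightarrow> bool"
  where "connected_graph M E \<longleftrightarrow> E \<subseteq> {..<M} \<times> {..<M} \<and> sym E \<and> irrefl E \<and>
    (\<forall>i<M. \<forall>j<M. (i, j) \<in> E\<^sup>*)"

definition gossip_matrix :: "nat \<Rightarrow> (nat \<times> nat) set \<Rightarrow> real mat \<Rightarrow> bool"
  where "gossip_matrix M E W \<longleftrightarrow> W \<in> carrier_mat M M \<and> transpose_mat W = W \<and>
    (\<forall>v\<in>carrier_vec M. 0 \<le> scalar_prod v (mult_mat_vec W v)) \<and>
    mat_kernel W = {v. \<exists>a. v = vec M (\<lambda>_. a)} \<and>
    (\<forall>i<M. \<forall>j<M. W $$ (i, j) \<noteq> 0 \<longrightarrow> i = j \<or> (i, j) \<in> E)"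

text \<open>All eigenvalues with their multiplicities, in decreasing order.\<close>

definition eigenvalue_list :: "real mat \<Rightarrow> real list"
  where "eigenvalue_list W = rev (sorted_list_of_multiset (proots (char_poly W)))"

text \<open>\<open>\<lambda>\<^sub>1 / \<lambda>\<^sub>M\<^sub>-\<^sub>1\<close>, where \<open>\<lambda>\<^sub>k\<close> is at position \<open>k - 1\<close> of the list.\<close>

definition condition_number :: "nat \<Rightarrow> real mat \<Rightarrow> real"
  where "condition_number M W = eigenvalue_list W ! 0 / eigenvalue_list W ! (M - 2)"

definition network ::
    "nat \<Rightarrow> real \<Rightarrow> (nat \<Rightarrow> (nat \<times> nat) set) \<Rightarrow> (nat \<Rightarrow> real mat) \<Rightarrow> bool"
  where "network M \<kappa> E W \<longleftrightarrow> 2 \<le> M \<and>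
    (\<forall>t. connected_graph M (E t) \<and> gossip_matrix M (E t) (W t)) \<and>
    (\<forall>t. condition_number M (W t) \<le> \<kappa>) \<and> (\<exists>t. condition_number M (W t) = \<kappa>)"


section \<open>Black-box algorithms\<close>

text \<open>The memories of all devices for one of the two variables.\<close>

type_synonym memories = "nat \<Rightarrow> rvec set"

definition local_computation ::
    "nat \<Rightarrow> (rvec \<times> rvec) set \<Rightarrow> (nat \<Rightarrow> objective) \<Rightarrow>
     memories \<Rightarrow> memories \<Rightarrow> memories \<Rightarrow> memories \<Rightarrow> bool"
  where "local_computation M S fs Mx My Mx' My' \<longleftrightarrow> (\<forall>m<M. \<exists>A B.
    finite A \<and> finite B \<and> Mx' m = Mx m \<union> A \<and> My' m = My m \<union> B \<and>
    (\<forall>x\<in>A. \<exists>x'\<in>Mx m. \<exists>x''\<in>Mx m. \<exists>y''\<in>My m.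
      x \<in> span {x', fst (grad S (fs m) (x'', y''))}) \<and>
    (\<forall>y\<in>B. \<exists>y'\<in>My m. \<exists>x''\<in>Mx m. \<exists>y''\<in>My m.
      y \<in> span {y', snd (grad S (fs m) (x'', y''))}))"

text \<open>
  Links join distinct devices, so a device that replaces its memory by the span of its neighbours'
  memories loses its own points. With \<open>keep\<close> it retains them, as in a gossip step
  that multiplies by \<open>W(t)\<close>. The lower bound is stated for both conventions.
\<close>

definition communicate :: "bool \<Rightarrow> (nat \<times> nat) set \<Rightarrow> memories \<Rightarrow> memories"
  where "communicate keep E Mem =
    (\<lambda>m. span (\<Union>i\<in>{i. (i, m) \<in> E \<or> keep \<and> i = m}. Mem i))"

text \<open>
  \<open>black_box_run keep M S fs E t k Mx My\<close>: some algorithm of the class reaches the memories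
  \<open>Mx, My\<close> after \<open>t\<close> communication rounds and \<open>k\<close> local computations. The moments of the
  network are its communication rounds: the next round uses \<open>E t\<close>.
\<close>

inductive black_box_run ::
    "bool \<Rightarrow> nat \<Rightarrow> (rvec \<times> rvec) set \<Rightarrow> (nat \<Rightarrow> objective) \<Rightarrow> (nat \<Rightarrow> (nat \<times> nat) set) \<Rightarrow>
     nat \<Rightarrow> nat \<Rightarrow> memories \<Rightarrow> memories \<Rightarrow> bool"
  for keep :: bool and M :: nat and S :: "(rvec \<times> rvec) set" and fs :: "nat \<Rightarrow> objective"
    and E :: "nat \<Rightarrow> (nat \<times> nat) set"
  where
    init: "black_box_run keep M S fs E 0 0 (\<lambda>_. {0}) (\<lambda>_. {0})"
  | local: "black_box_run keep M S fs E t k Mx My \<Longrightarrow>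
      local_computation M S fs Mx My Mx' My' \<Longrightarrow>
      black_box_run keep M S fs E t (Suc k) Mx' My'"
  | communication: "black_box_run keep M S fs E t k Mx My \<Longrightarrow>
      black_box_run keep M S fs E (Suc t) k
        (communicate keep (E t) Mx) (communicate keep (E t) My)"

definition black_box_output ::
    "bool \<Rightarrow> nat \<Rightarrow> (rvec \<times> rvec) set \<Rightarrow> (nat \<Rightarrow> objective) \<Rightarrow> (nat \<Rightarrow> (nat \<times> nat) set) \<Rightarrow>
     nat \<Rightarrow> nat \<Rightarrow> rvec \<times> rvec \<Rightarrow> bool"
  where "black_box_output keep M S fs E t k z \<longleftrightarrow>
    (\<exists>Mx My. black_box_run keep M S fs E t k Mx My \<and>
      fst z \<in> span (\<Union>m<M. Mx m) \<and> snd z \<in> span (\<Union>m<M. My m))"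

text \<open>
  Any algorithm needs at least \<open>a\<close> communication rounds and at least \<open>b\<close> local computations to
  reach accuracy \<open>e\<close>. A solution is required to exist, as otherwise the bound is vacuous.
\<close>

definition complexity_at_least ::
    "nat \<Rightarrow> (rvec \<times> rvec) set \<Rightarrow> rvec set \<Rightarrow> rvec set \<Rightarrow> (nat \<Rightarrow> objective) \<Rightarrow>
     (nat \<Rightarrow> (nat \<times> nat) set) \<Rightarrow> real \<Rightarrow> real \<Rightarrow> real \<Rightarrow> bool"
  where "complexity_at_least M S X Y fs E e a b \<longleftrightarrow>
    (\<exists>zs. saddle_point X Y (average M fs) zs) \<and>
    (\<forall>keep t k z. black_box_output keep M S fs E t k z \<longrightarrow>
      dist_accurate X Y (average M fs) e z \<longrightarrow> a \<le> real t \<and> b \<le> real k)"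

end

(*
Lower bound: for f(x, y) = (L/2) (sum_i x_i y_i - sum_i x_i y_(i+1) - b y_0) order the coordinates as
y_0, x_0, y_1, x_1, ... From the zero vector, a gradient reaches one new coordinate of this chain at
a time. Device 0 holds the couplings x_i y_i and device 1 all the others, so consecutive coordinates
are reached by different devices. Between the two, information has to be relayed through star graphs
with about kappa vertices whose centre moves on in every round, always to a device that has not heard
the news yet; one transfer takes about kappa rounds. With about L D^2 / (2 eps) coordinates, the
saddle points of f and of its regularization have all x_i of comparable size, so the undiscovered
half of the coordinates keeps the output at squared distance at least D^2 / 32.
*)
theory Submission
  imports Defs
begin

hide_const (open) VectorSpace.subspace
unbundle no vec_syntax and no inner_syntax

section \<open>Gradients within the ambient space and regularization\<close>

text \<open>The chain is bilinear, and regularizing at the origin only adds quadratic terms, so one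
  family \<open>chain_obj\<close> covers the devices, their average and its regularization; a single
  complexity bound with parameter \<open>\<mu>\<close> then serves both problems
  (\<open>\<mu> = 0\<close> and \<open>\<mu> = \<epsilon> / (2 * D\<^sup>2)\<close>). The length N
  of the chain is a compromise. Both bounds grow with N, but the regularized solution decays along
  the chain, at a rate governed by \<open>\<mu> / a = \<epsilon> / (L * D\<^sup>2)\<close> with
  \<open>a = L / 2\<close>. Up to N times this ratio equal to 1/2, the x-coordinates stay within a
  factor 2 of each other; this fixes N. The obstacle is the case \<open>\<mu> = 0\<close>: the
  stationary point then has its x-part on the bounding sphere, so y need not be unique, while
  accuracy may refer to any saddle point. Distances are therefore measured in x alone, where
  uniqueness does hold. Stars only have integer condition numbers. The prescribed value
  \<open>\<kappa>\<close> is attained by a matrix on a complete graph, placed after the rounds that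
  the bound is about.\<close>

lemma lookup_eq_inner: "Poly_Mapping.lookup v i = inner v (Poly_Mapping.single i 1)"
  for v :: "'a \<Rightarrow>\<^sub>0 real"
proof -
  have "inner (Poly_Mapping.single i 1) v = Poly_Mapping.lookup v i"
    by (subst inner_poly_mapping_superset[of "{i}"]) (auto simp: lookup_single)
  then show ?thesis by (simp add: inner_commute)
qed

lemma euclid_iff: "v \<in> euclid n \<longleftrightarrow> (\<forall>i\<ge>n. Poly_Mapping.lookup v i = 0)"
  by (auto simp: euclid_def in_keys_iff subset_eq not_less[symmetric])

lemma euclid_inner:
  assumes "v \<in> euclid n"
  shows "inner v w = (\<Sum>i<n. Poly_Mapping.lookup v i * Poly_Mapping.lookup w i)"
  using assms by (subst inner_poly_mapping_superset[of "{..<n}"]) (auto simp: euclid_def)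

lemma euclid_norm_sq:
  assumes "v \<in> euclid n"
  shows "(norm v)\<^sup>2 = (\<Sum>i<n. (Poly_Mapping.lookup v i)\<^sup>2)"
  unfolding power2_norm_eq_inner euclid_inner[OF assms] by (simp add: power2_eq_square)

lemma subspace_euclid: "subspace (euclid n)"
  by (rule subspaceI) (auto simp: euclid_iff lookup_add)

lemma subspace_ambient: "subspace (ambient nx ny)"
  unfolding ambient_def by (intro subspace_Times subspace_euclid)

lemma single_in_euclid: "i < n \<Longrightarrow> Poly_Mapping.single i c \<in> euclid n"
  by (auto simp: euclid_iff lookup_single when_def)

lemma lookup_sum_single:
  "Poly_Mapping.lookup (\<Sum>k<n. Poly_Mapping.single (g k) (c k)) i
     = (\<Sum>k<n. if g k = i then c k else 0)"
  for c :: "nat \<Rightarrow> real"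
  by (simp add: lookup_sum lookup_single when_def)

lemma euclid_expansion:
  assumes "v \<in> euclid n"
  shows "v = (\<Sum>i<n. Poly_Mapping.lookup v i *\<^sub>R Poly_Mapping.single i 1)"
proof (rule poly_mapping_eqI)
  fix k
  have "(\<Sum>i<n. Poly_Mapping.lookup v i * (1 when i = k)) = (if k < n then Poly_Mapping.lookup v k else 0)"
    by (simp add: when_def if_distrib cong: if_cong)
  then show "Poly_Mapping.lookup v k =
      Poly_Mapping.lookup (\<Sum>i<n. Poly_Mapping.lookup v i *\<^sub>R Poly_Mapping.single i 1) k"
    using assms by (auto simp: lookup_sum lookup_single euclid_iff)
qed

text \<open>A derivative within \<open>S\<close> is tested along the line through \<open>z\<close>
  in the direction \<open>g - g'\<close>, which stays in the subspace. This makes the definite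
  description in \<open>grad\<close> meaningful.\<close>

lemma grad_unique:
  assumes S: "subspace S" and z: "z \<in> S"
    and g: "g \<in> S" "(f has_derivative (\<lambda>h. inner g h)) (at z within S)"
    and g': "g' \<in> S" "(f has_derivative (\<lambda>h. inner g' h)) (at z within S)"
  shows "g = g'"
proof -
  define h where "h = g - g'"
  have hS: "h \<in> S" using S g g' by (simp add: h_def subspace_diff)
  define \<phi> where "\<phi> t = z + t *\<^sub>R h" for t :: real
  have \<phi>: "(\<phi> has_derivative (\<lambda>t. t *\<^sub>R h)) (at 0)"
    unfolding \<phi>_def by (auto intro!: derivative_eq_intros)
  have im: "range \<phi> \<subseteq> S"
    using S z hS by (auto simp: \<phi>_def subspace_add subspace_scale)
  have comp: "((\<lambda>t. f (\<phi> t)) has_derivative (\<lambda>t. inner u (t *\<^sub>R h))) (at 0)"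
    if "(f has_derivative (\<lambda>h. inner u h)) (at z within S)" for u
  proof -
    have "(f has_derivative (\<lambda>h. inner u h)) (at (\<phi> 0) within range \<phi>)"
      using that im by (auto simp: \<phi>_def intro: has_derivative_subset)
    from has_derivative_in_compose[OF \<phi> this] show ?thesis .
  qed
  have "(\<lambda>t. inner g (t *\<^sub>R h)) = (\<lambda>t. inner g' (t *\<^sub>R h))"
    using has_derivative_unique[OF comp[OF g(2)] comp[OF g'(2)]] .
  from fun_cong[OF this, of 1] have "inner (g - g') h = 0" by (simp add: inner_diff_left)
  then show ?thesis by (simp add: h_def)
qed

lemma grad_eqI:
  assumes "subspace S" "z \<in> S" "g \<in> S" "(f has_derivative (\<lambda>h. inner g h)) (at z within S)"
  shows "grad S f z = g"
  unfolding grad_def by (rule the_equality) (use assms grad_unique in blast)+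

text \<open>Difference quotients within \<open>S\<close> evaluate the derivative only at
  \<open>y - z\<close>, an element of the subspace.\<close>

lemma has_derivative_within_subspace_cong:
  assumes S: "subspace S" and z: "z \<in> S"
    and f: "(f has_derivative f') (at z within S)" and g: "bounded_linear g"
    and eq: "\<And>h. h \<in> S \<Longrightarrow> f' h = g h"
  shows "(f has_derivative g) (at z within S)"
proof -
  have "((\<lambda>y. (f y - f z - f' (y - z)) /\<^sub>R norm (y - z)) \<longlongrightarrow> 0) (at z within S)"
    using f by (simp add: has_derivative_at_within)
  moreover have "\<forall>\<^sub>F y in at z within S.
      (f y - f z - f' (y - z)) /\<^sub>R norm (y - z) = (f y - f z - g (y - z)) /\<^sub>R norm (y - z)"
    unfolding eventually_at_filter
    by (rule always_eventually) (use S z eq in \<open>auto simp: subspace_diff\<close>)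
  ultimately have "((\<lambda>y. (f y - f z - g (y - z)) /\<^sub>R norm (y - z)) \<longlongrightarrow> 0) (at z within S)"
    by (rule Lim_transform_eventually)
  with g show ?thesis by (simp add: has_derivative_at_within)
qed

text \<open>The type \<open>rvec\<close> is an incomplete inner product space, so a functional need
  not be an inner product on all of it. On finitely many coordinates the representing vector is read
  off from the values at the basis vectors.\<close>

lemma ambient_riesz:
  assumes "linear f'"
  shows "\<exists>g\<in>ambient nx ny. \<forall>h\<in>ambient nx ny. f' h = inner g h"
proof -
  interpret linear f' by fact
  let ?e = "\<lambda>i. Poly_Mapping.single i (1::real)"
  define gx where "gx = (\<Sum>i<nx. f' (?e i, 0) *\<^sub>R ?e i)"
  define gy where "gy = (\<Sum>i<ny. f' (0, ?e i) *\<^sub>R ?e i)"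
  have "(gx, gy) \<in> ambient nx ny"
    unfolding ambient_def gx_def gy_def
    by (auto intro!: subspace_sum subspace_scale subspace_euclid single_in_euclid)
  moreover have "f' (hx, hy) = inner (gx, gy) (hx, hy)" if "hx \<in> euclid nx" "hy \<in> euclid ny" for hx hy
  proof -
    let ?l = "Poly_Mapping.lookup"
    have "(hx, hy) = (\<Sum>i<nx. ?l hx i *\<^sub>R (?e i, 0)) + (\<Sum>i<ny. ?l hy i *\<^sub>R (0, ?e i))"
      using euclid_expansion[OF that(1)] euclid_expansion[OF that(2)]
      by (simp add: sum_prod prod_eq_iff fst_sum snd_sum)
    then have "f' (hx, hy) = f' ((\<Sum>i<nx. ?l hx i *\<^sub>R (?e i, 0)) + (\<Sum>i<ny. ?l hy i *\<^sub>R (0, ?e i)))"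
      by simp
    also have "\<dots> = (\<Sum>i<nx. ?l hx i * f' (?e i, 0)) + (\<Sum>i<ny. ?l hy i * f' (0, ?e i))"
      by (simp only: add sum scale) simp
    also have "\<dots> = inner (gx, gy) (hx, hy)"
      by (simp add: gx_def gy_def lookup_eq_inner inner_commute[of _ hx] inner_commute[of _ hy]
        inner_sum_right mult.commute)
    finally show ?thesis .
  qed
  ultimately show ?thesis by (auto simp: ambient_def)
qed

lemma grad_spec:
  assumes f: "f differentiable_on ambient nx ny" and z: "z \<in> ambient nx ny"
  shows "grad (ambient nx ny) f z \<in> ambient nx ny \<and>
    (f has_derivative (\<lambda>h. inner (grad (ambient nx ny) f z) h)) (at z within ambient nx ny)"
proof -
  let ?S = "ambient nx ny"
  obtain f' where f': "(f has_derivative f') (at z within ?S)"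
    using f z by (auto simp: differentiable_on_def differentiable_def)
  obtain g where g: "g \<in> ?S" "\<forall>h\<in>?S. f' h = inner g h"
    using ambient_riesz[OF has_derivative_linear[OF f']] by blast
  have "(f has_derivative (\<lambda>h. inner g h)) (at z within ?S)"
    by (rule has_derivative_within_subspace_cong[OF subspace_ambient z f'])
      (use g in \<open>auto intro: bounded_linear_inner_right\<close>)
  then show ?thesis
    using grad_eqI[OF subspace_ambient z g(1)] g(1) by simp
qed

section \<open>Effect of the regularization on gradients and on the gap\<close>

lemma regularized_eq:
  "regularized \<epsilon> D z0 f = (\<lambda>z. f z + \<epsilon> / (4 * D\<^sup>2) *
     ((norm (fst z - fst z0))\<^sup>2 - (norm (snd z - snd z0))\<^sup>2))"
  by (auto simp: regularized_def algebra_simps)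

lemma regularized_grad:
  fixes \<epsilon> D :: real
  assumes f: "f differentiable_on ambient nx ny" and z: "z \<in> ambient nx ny" "z0 \<in> ambient nx ny"
  defines "g \<equiv> grad (ambient nx ny) f z +
    (\<epsilon> / (2 * D\<^sup>2)) *\<^sub>R (fst z - fst z0, snd z0 - snd z)"
  shows "(regularized \<epsilon> D z0 f has_derivative (\<lambda>h. inner g h)) (at z within ambient nx ny)"
    and "grad (ambient nx ny) (regularized \<epsilon> D z0 f) z = g"
proof -
  let ?S = "ambient nx ny"
  have "((\<lambda>z. k * (inner (fst z - fst z0) (fst z - fst z0) -
       inner (snd z - snd z0) (snd z - snd z0))) has_derivative
     (\<lambda>h. k * (2 * inner (fst z - fst z0, snd z0 - snd z) h))) (at z within ?S)" for k :: real
    by (auto intro!: derivative_eq_intros ext simp: inner_prod_def inner_commute algebra_simps)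
  then have "((\<lambda>z. \<epsilon> / (4 * D\<^sup>2) * ((norm (fst z - fst z0))\<^sup>2 - (norm (snd z - snd z0))\<^sup>2)) has_derivative
     (\<lambda>h. \<epsilon> / (4 * D\<^sup>2) * (2 * inner (fst z - fst z0, snd z0 - snd z) h))) (at z within ?S)"
    unfolding power2_norm_eq_inner .
  from has_derivative_add[OF conjunct2[OF grad_spec[OF f z(1)]] this]
  show d: "(regularized \<epsilon> D z0 f has_derivative (\<lambda>h. inner g h)) (at z within ?S)"
    unfolding regularized_eq g_def inner_add_left inner_scaleR_left
    by (simp add: field_simps)
  have "(fst z - fst z0, snd z0 - snd z) \<in> ?S"
    using z subspace_euclid by (auto simp: ambient_def subspace_diff)
  then have "g \<in> ?S"
    unfolding g_def using grad_spec[OF f z(1)] by (intro subspace_add subspace_scale subspace_ambient) auto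
  then show "grad ?S (regularized \<epsilon> D z0 f) z = g"
    by (intro grad_eqI subspace_ambient z(1) d)
qed

lemma regularized_strongly_convex_concave:
  assumes f: "convex_concave (ambient nx ny) Z f" and Z: "Z \<subseteq> ambient nx ny" "z0 \<in> Z"
  shows "strongly_convex_concave (ambient nx ny) Z (\<epsilon> / (2 * D\<^sup>2)) (regularized \<epsilon> D z0 f)"
  unfolding strongly_convex_concave_def
proof (intro conjI ballI)
  let ?S = "ambient nx ny" let ?r = "regularized \<epsilon> D z0 f" and ?\<mu> = "\<epsilon> / (2 * D\<^sup>2)"
  have fd: "f differentiable_on ?S" using f by (simp add: strongly_convex_concave_def)
  have z0: "z0 \<in> ?S" using Z by auto
  show "?r differentiable_on ?S"
    using regularized_grad(1)[OF fd _ z0] unfolding differentiable_on_def differentiable_def by blast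
  fix z1 z2 assume z: "z1 \<in> Z" "z2 \<in> Z"
  then have zS: "z1 \<in> ?S" "z2 \<in> ?S" using Z by auto
  \<comment> \<open>The sign change in the y-part turns the concave penalty into the same multiple
    of the displacement as the convex one.\<close>
  have op: "saddle_operator ?S ?r z = saddle_operator ?S f z + ?\<mu> *\<^sub>R (z - z0)" if "z \<in> ?S" for z
    unfolding saddle_operator_def regularized_grad(2)[OF fd that z0]
    by (auto simp: prod_eq_iff algebra_simps)
  have "saddle_operator ?S ?r z1 - saddle_operator ?S ?r z2
      = (saddle_operator ?S f z1 - saddle_operator ?S f z2) + ?\<mu> *\<^sub>R (z1 - z2)"
    by (simp add: op zS algebra_simps)
  then have "inner (saddle_operator ?S ?r z1 - saddle_operator ?S ?r z2) (z1 - z2)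
      = inner (saddle_operator ?S f z1 - saddle_operator ?S f z2) (z1 - z2) + ?\<mu> * (norm (z1 - z2))\<^sup>2"
    by (simp only: inner_add_left inner_scaleR_left power2_norm_eq_inner)
  with f z show "?\<mu> * (norm (z1 - z2))\<^sup>2 \<le> inner (saddle_operator ?S ?r z1 - saddle_operator ?S ?r z2) (z1 - z2)"
    by (simp add: strongly_convex_concave_def)
qed

lemma regularized_gap_accurate:
  assumes D: "0 < D" and \<epsilon>: "0 < \<epsilon>" and X: "convex_body nx D X" and Y: "convex_body ny D Y"
    and z0: "z0 \<in> X \<times> Y" and gap: "gap_accurate X Y (regularized \<epsilon> D z0 f) (\<epsilon> / 2) z"
  shows "gap_accurate X Y f \<epsilon> z"
  unfolding gap_accurate_def
proof (intro conjI ballI)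
  show z: "z \<in> X \<times> Y" using gap by (simp add: gap_accurate_def)
  fix x' y' assume xy: "x' \<in> X" "y' \<in> Y"
  let ?c = "\<epsilon> / (4 * D\<^sup>2)"
  have dist: "(norm (v - w))\<^sup>2 \<le> D\<^sup>2" if "convex_body n D V" "v \<in> V" "w \<in> V" for n V and v w :: rvec
    using diameter_bounded_bound[of V v w] that by (auto simp: convex_body_def dist_norm intro!: power_mono)
  have "regularized \<epsilon> D z0 f (fst z, y') - regularized \<epsilon> D z0 f (x', snd z) \<le> \<epsilon> / 2"
    using gap xy by (simp add: gap_accurate_def)
  then have "f (fst z, y') - f (x', snd z) \<le> \<epsilon> / 2 + ?c * ((norm (x' - fst z0))\<^sup>2 + (norm (y' - snd z0))\<^sup>2)
       - ?c * ((norm (fst z - fst z0))\<^sup>2 + (norm (snd z - snd z0))\<^sup>2)"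
    by (simp add: regularized_eq algebra_simps)
  \<comment> \<open>The penalties at \<open>x'\<close> and \<open>y'\<close> are at most
    \<open>D\<^sup>2\<close> each; those at \<open>z\<close> have a favourable sign and are
    dropped.\<close>
  also have "\<dots> \<le> \<epsilon> / 2 + ?c * (D\<^sup>2 + D\<^sup>2) - 0"
    using xy z0 \<epsilon> by (intro diff_mono add_mono mult_left_mono dist[OF X] dist[OF Y]) auto
  also have "\<dots> = \<epsilon>" using D by (simp add: field_simps)
  finally show "f (fst z, y') - f (x', snd z) \<le> \<epsilon>" .
qed

section \<open>Gossip matrices of stars and complete graphs\<close>

lemma proots_prod_list_linear:
  "proots (\<Prod>a\<leftarrow>xs. [:- a, 1:]) = mset (xs :: real list)"
proof (induction xs)
  case (Cons a xs)
  have nz: "(\<Prod>a\<leftarrow>xs. [:- a, 1:]) \<noteq> 0" for xs :: "real list"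
    by auto
  have "proots [:- a, 1:] = {#a#}" by simp
  moreover have "proots ([:- a, 1:] * (\<Prod>a\<leftarrow>xs. [:- a, 1:])) = proots [:- a, 1:] + mset xs"
    by (subst proots_mult) (use nz Cons in \<open>auto simp del: mult_pCons_left\<close>)
  ultimately show ?case by (simp del: mult_pCons_left)
qed simp

text \<open>\<open>eigenvalue_list\<close> takes its multiplicities from the characteristic
  polynomial, so a full eigenbasis, the columns of \<open>P\<close>, is supplied together with its
  inverse \<open>Q\<close>.\<close>

lemma eigenvalue_list_diagonalizable:
  assumes "W \<in> carrier_mat M M" "P \<in> carrier_mat M M" "Q \<in> carrier_mat M M"
    and PQ: "P * Q = 1\<^sub>m M" and WP: "W * P = P * mat_diag M d"
  shows "eigenvalue_list W = rev (sort (map d [0..<M]))"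
proof -
  let ?D = "mat_diag M d :: real mat"
  have D: "?D \<in> carrier_mat M M" by simp
  have QP: "Q * P = 1\<^sub>m M" by (rule mat_mult_left_right_inverse[OF assms(2,3) PQ])
  have "W = W * (P * Q)" using assms by simp
  also have "\<dots> = P * ?D * Q"
    unfolding WP[symmetric] by (rule assoc_mult_mat[symmetric]) (rule assms)+
  finally have WD: "W = P * ?D * Q" .
  have "dim_row W = M" using assms(1) by simp
  then have "similar_mat_wit W ?D P Q"
    unfolding similar_mat_wit_def Let_def using assms(1-3) D PQ QP WD by blast
  then have "char_poly W = char_poly ?D"
    by (intro char_poly_similar) (auto simp: similar_mat_def)
  also have "\<dots> = (\<Prod>a\<leftarrow>diag_mat ?D. [:- a, 1:])"
    by (rule char_poly_upper_triangular[OF D]) (auto simp: upper_triangular_def mat_diag_def)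
  finally have "proots (char_poly W) = mset (diag_mat ?D)"
    by (simp add: proots_prod_list_linear)
  moreover have "diag_mat ?D = map d [0..<M]"
    by (auto simp: diag_mat_def mat_diag_def intro!: map_cong)
  ultimately have "sorted_list_of_multiset (proots (char_poly W)) = sort (map d [0..<M])"
    by (simp only: sorted_list_of_multiset_mset)
  then show ?thesis
    by (simp add: eigenvalue_list_def)
qed

lemma mat_entry_mult:
  assumes "A \<in> carrier_mat n n" "B \<in> carrier_mat n n" "i < n" "j < n"
  shows "(A * B) $$ (i, j) = (\<Sum>k<n. A $$ (i, k) * B $$ (k, j))"
  using assms by (auto simp: scalar_prod_def atLeast0LessThan intro!: sum.cong)

text \<open>
  \<open>I - J / M + s / (M (M - 1)) u u\<^sup>T\<close> with \<open>u = M e\<^sub>c - 1\<close> has the eigenvalues \<open>0\<close>, \<open>1 + s\<close> and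
  \<open>1\<close> (\<open>M - 2\<close> times). For \<open>s = M - 1\<close> it is the Laplacian of the star with centre \<open>c\<close>.
\<close>

definition hub_vec :: "nat \<Rightarrow> nat \<Rightarrow> nat \<Rightarrow> real"
  where "hub_vec M c i = (if i = c then real M - 1 else - 1)"

definition hub_mat :: "nat \<Rightarrow> nat \<Rightarrow> real \<Rightarrow> real mat"
  where "hub_mat M c s = mat M M (\<lambda>(i, j). of_bool (i = j) - 1 / real M +
    s / (real M * (real M - 1)) * (hub_vec M c i * hub_vec M c j))"

lemma sum_hub_vec_mult:
  assumes "c < M"
  shows "(\<Sum>k<M. hub_vec M c k * f k) = real M * f c - (\<Sum>k<M. f k)"
proof -
  have "(\<Sum>k<M. hub_vec M c k * f k) = (\<Sum>k<M. (if k = c then real M * f c else 0) - f k)"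
    by (intro sum.cong) (auto simp: hub_vec_def algebra_simps)
  then show ?thesis using assms by (simp add: sum_subtractf)
qed

lemma hub_mat_sum:
  assumes "c < M" "i < M"
  shows "(\<Sum>k<M. hub_mat M c s $$ (i, k) * f k) =
    f i - (\<Sum>k<M. f k) / real M +
      s / (real M * (real M - 1)) * hub_vec M c i * (real M * f c - (\<Sum>k<M. f k))"
proof -
  have "(\<Sum>k<M. hub_mat M c s $$ (i, k) * f k) =
    (\<Sum>k<M. of_bool (i = k) * f k - f k / real M +
      s / (real M * (real M - 1)) * hub_vec M c i * (hub_vec M c k * f k))"
    using assms by (intro sum.cong) (auto simp: hub_mat_def algebra_simps)
  also have "\<dots> = f i - (\<Sum>k<M. f k) / real M +
      s / (real M * (real M - 1)) * hub_vec M c i * (\<Sum>k<M. hub_vec M c k * f k)"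
    using assms by (simp add: sum.distrib sum_subtractf sum_distrib_left sum_divide_distrib)
  finally show ?thesis by (simp add: sum_hub_vec_mult[OF assms(1)])
qed

text \<open>An entry of \<open>P * Q\<close> in the next proof, with \<open>r\<close> for the number
  of devices: the contributions of the indices \<open>c\<close> and \<open>b\<close>, then the
  collapsed sum over all others.\<close>

lemma hub_inverse_entry:
  fixes r :: real
  assumes "1 < r" "b \<noteq> c"
  shows "(if i = c then r - 1 else - 1) * ((of_bool (j = c) - of_bool (j \<noteq> c) / (r - 1)) / r) +
    1 * (1 / r) +
    ((if i = b \<or> i = c then 0 else of_bool (i = j) - of_bool (j \<noteq> c) / (r - 1)) +
      (if j = b \<or> j = c then 0 else - of_bool (i = b)) +
      (r - 2) * (of_bool (i = b) * (of_bool (j \<noteq> c) / (r - 1)))) = of_bool (i = j)"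
  using assms
  apply (cases "i = c"; cases "i = b"; cases "j = c"; cases "j = b"; cases "i = j")
  apply simp_all
  apply (simp_all add: divide_simps)
  done

lemma hub_mat_condition_number:
  assumes M: "3 \<le> M" and c: "c < M" and s: "0 \<le> s"
  shows "condition_number M (hub_mat M c s) = 1 + s"
proof -
  define b where "b = (if c = 0 then 1 else 0 :: nat)"
  have b: "b < M" "b \<noteq> c" using M by (auto simp: b_def)
  \<comment> \<open>Column \<open>c\<close> is the vector u of the star, column \<open>b\<close> the
    constant vector, and the others are differences of unit vectors, orthogonal to both.\<close>
  define P :: "real mat" where "P = mat M M (\<lambda>(i, j).
    if j = c then hub_vec M c i else if j = b then 1 else of_bool (i = j) - of_bool (i = b))"
  define Q :: "real mat" where "Q = mat M M (\<lambda>(i, j).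
    if i = c then (of_bool (j = c) - of_bool (j \<noteq> c) / (real M - 1)) / real M
    else if i = b then 1 / real M
    else of_bool (j = i) - of_bool (j \<noteq> c) / (real M - 1))"
  define d where "d i = (if i = c then 1 + s else if i = b then 0 else 1)" for i
  have M0: "real M > 0" "real M - 1 > 0" using M by auto
  have M1: "1 < real M" using M by auto
  have carr: "hub_mat M c s \<in> carrier_mat M M" "P \<in> carrier_mat M M" "Q \<in> carrier_mat M M"
    by (auto simp: hub_mat_def P_def Q_def)
  have sum_c: "(\<Sum>k<M. hub_vec M c k) = 0"
    using sum_hub_vec_mult[OF c, of "\<lambda>_. 1"] by simp
  have "eigenvalue_list (hub_mat M c s) = rev (sort (map d [0..<M]))"
  proof (rule eigenvalue_list_diagonalizable[OF carr])
    have split: "{..<M} = insert c (insert b ({..<M} - {b, c}))" using b c by auto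
    show "P * Q = 1\<^sub>m M"
    proof (rule eq_matI)
      fix i j assume ij: "i < dim_row (1\<^sub>m M)" "j < dim_col (1\<^sub>m M)"
      have "(P * Q) $$ (i, j) = (\<Sum>k<M. P $$ (i, k) * Q $$ (k, j))"
        using ij carr by (intro mat_entry_mult) auto
      also have "\<dots> = P $$ (i, c) * Q $$ (c, j) + P $$ (i, b) * Q $$ (b, j) +
          (\<Sum>k\<in>{..<M} - {b, c}. P $$ (i, k) * Q $$ (k, j))"
        using b by (subst split) simp
      also have "(\<Sum>k\<in>{..<M} - {b, c}. P $$ (i, k) * Q $$ (k, j)) =
         (\<Sum>k\<in>{..<M} - {b, c}. (of_bool (i = k) - of_bool (i = b)) * (of_bool (j = k) - of_bool (j \<noteq> c) / (real M - 1)))"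
        using ij by (intro sum.cong) (auto simp: P_def Q_def)
      also have "\<dots> = (\<Sum>k\<in>{..<M} - {b, c}.
          (if k = i then of_bool (i = j) - of_bool (j \<noteq> c) / (real M - 1) else 0) +
          (if k = j then - of_bool (i = b) else 0) + of_bool (i = b) * (of_bool (j \<noteq> c) / (real M - 1)))"
        by (intro sum.cong) auto
      also have "\<dots> = (if i = b \<or> i = c then 0 else of_bool (i = j) - of_bool (j \<noteq> c) / (real M - 1)) +
          (if j = b \<or> j = c then 0 else - of_bool (i = b)) +
          (real M - 2) * (of_bool (i = b) * (of_bool (j \<noteq> c) / (real M - 1)))"
        using ij b c M by (simp add: sum.distrib card_Diff_subset)
      finally have PQ: "(P * Q) $$ (i, j) = P $$ (i, c) * Q $$ (c, j) + P $$ (i, b) * Q $$ (b, j) + \<dots>" .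
      have entries: "P $$ (i, c) = (if i = c then real M - 1 else - 1)"
        "Q $$ (c, j) = (of_bool (j = c) - of_bool (j \<noteq> c) / (real M - 1)) / real M"
        "P $$ (i, b) = 1" "Q $$ (b, j) = 1 / real M"
        using ij b c by (simp_all add: P_def Q_def hub_vec_def)
      show "(P * Q) $$ (i, j) = 1\<^sub>m M $$ (i, j)"
        unfolding PQ entries hub_inverse_entry[OF M1 b(2)] using ij by simp
    qed (use carr in auto)
    show "hub_mat M c s * P = P * mat_diag M d"
    proof (rule eq_matI)
      fix i j assume ij: "i < dim_row (P * mat_diag M d)" "j < dim_col (P * mat_diag M d)"
      then have ij: "i < M" "j < M" using carr by (auto simp: mat_diag_def)
      have colsum: "(\<Sum>k<M. P $$ (k, j)) = (if j = b then real M else 0)"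
      proof -
        have "(\<Sum>k<M. P $$ (k, j)) = (\<Sum>k<M. if j = c then hub_vec M c k else if j = b then 1 else (if k = j then 1 else 0) - (if k = b then 1 else 0))"
          using ij by (intro sum.cong) (auto simp: P_def)
        also have "\<dots> = (if j = b then real M else 0)"
          using sum_c ij(2) b by (cases "j = c"; cases "j = b") (simp_all add: sum_subtractf)
        finally show ?thesis .
      qed
      have "(hub_mat M c s * P) $$ (i, j) = (\<Sum>k<M. hub_mat M c s $$ (i, k) * P $$ (k, j))"
        using ij carr by (intro mat_entry_mult) auto
      also have "\<dots> = d j * P $$ (i, j)"
        unfolding hub_mat_sum[OF c ij(1)] colsum using ij c b M0
        by (auto simp: P_def d_def hub_vec_def field_simps)
      also have "\<dots> = (P * mat_diag M d) $$ (i, j)"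
        using ij carr by (subst mat_diag_mult_right[of _ M]) auto
      finally show "(hub_mat M c s * P) $$ (i, j) = (P * mat_diag M d) $$ (i, j)" .
    qed (use carr in \<open>auto simp: mat_diag_def\<close>)
  qed
  also have "mset (map d [0..<M]) = mset (0 # replicate (M - 2) 1 @ [1 + s])"
  proof -
    have "mset (map d [0..<M]) = image_mset d (mset_set {..<M})"
      by (simp add: atLeast0LessThan)
    also have "mset_set {..<M} = add_mset c (add_mset b (mset_set ({..<M} - {b, c})))"
    proof -
      have split: "{..<M} = insert c (insert b ({..<M} - {b, c}))" using b c by auto
      show ?thesis using b by (subst split) (simp add: mset_set.insert_remove)
    qed
    finally have "mset (map d [0..<M]) = add_mset (d c) (add_mset (d b) (image_mset d (mset_set ({..<M} - {b, c}))))"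
      by simp
    moreover have "image_mset d (mset_set ({..<M} - {b, c})) = image_mset (\<lambda>_. 1) (mset_set ({..<M} - {b, c}))"
      by (intro image_mset_cong) (auto simp: d_def)
    moreover have "\<dots> = replicate_mset (M - 2) 1"
      using b c by (simp add: image_mset_const_eq card_Diff_subset numeral_2_eq_2)
    ultimately show ?thesis using b by (simp add: d_def)
  qed
  then have "sort (map d [0..<M]) = 0 # replicate (M - 2) 1 @ [1 + s]"
    using s by (intro properties_for_sort) (auto simp: sorted_append)
  finally have *: "eigenvalue_list (hub_mat M c s) = (1 + s) # replicate (M - 2) 1 @ [0]" by simp
  have "eigenvalue_list (hub_mat M c s) ! (M - 2) = 1"
    unfolding * using M by (auto simp: nth_Cons' nth_append)
  then show ?thesis by (simp add: condition_number_def *)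
qed

lemma hub_mat_gossip:
  assumes M: "3 \<le> M" and c: "c < M" and s: "0 \<le> s"
    and E: "\<And>i j. i < M \<Longrightarrow> j < M \<Longrightarrow> i \<noteq> j \<Longrightarrow> (s = real M - 1 \<longrightarrow> i = c \<or> j = c) \<Longrightarrow> (i, j) \<in> E"
  shows "gossip_matrix M E (hub_mat M c s)"
proof -
  let ?W = "hub_mat M c s"
  have M0: "real M > 0" "real M - 1 > 0" using M by auto
  have W: "?W \<in> carrier_mat M M" by (simp add: hub_mat_def)
  have mv: "(?W *\<^sub>v v) $ i = v $ i - (\<Sum>k<M. v $ k) / real M +
      s / (real M * (real M - 1)) * hub_vec M c i * (real M * v $ c - (\<Sum>k<M. v $ k))"
    if "v \<in> carrier_vec M" "i < M" for v i
    unfolding hub_mat_sum[OF c that(2), symmetric]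
    using that W by (auto simp: mult_mat_vec_def scalar_prod_def atLeast0LessThan intro!: sum.cong)
  \<comment> \<open>A sum of squares whose first part is the squared distance of \<open>v\<close> to
    the constant vectors: both semidefiniteness and the kernel follow.\<close>
  have form: "v \<bullet> (?W *\<^sub>v v) = (\<Sum>i<M. (v $ i - (\<Sum>k<M. v $ k) / real M)\<^sup>2) +
      s / (real M * (real M - 1)) * (real M * v $ c - (\<Sum>k<M. v $ k))\<^sup>2"
    if v: "v \<in> carrier_vec M" for v
  proof -
    define A where "A = (\<Sum>k<M. v $ k)"
    have "v \<bullet> (?W *\<^sub>v v) = (\<Sum>i<M. v $ i * (?W *\<^sub>v v) $ i)"
      using W by (auto simp: scalar_prod_def atLeast0LessThan hub_mat_def)
    also have "\<dots> = (\<Sum>i<M. v $ i * (v $ i - A / real M) +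
        s / (real M * (real M - 1)) * (real M * v $ c - A) * (hub_vec M c i * v $ i))"
      by (intro sum.cong) (auto simp: mv[OF v] A_def distrib_left mult_ac)
    also have "\<dots> = (\<Sum>i<M. v $ i * (v $ i - A / real M)) +
        s / (real M * (real M - 1)) * (real M * v $ c - A) * (real M * v $ c - A)"
      unfolding sum.distrib sum_distrib_left[symmetric] sum_hub_vec_mult[OF c] A_def by simp
    also have "(\<Sum>i<M. v $ i * (v $ i - A / real M)) = (\<Sum>i<M. (v $ i - A / real M)\<^sup>2)"
    proof -
      have "(\<Sum>i<M. v $ i * (v $ i - A / real M)) - (\<Sum>i<M. (v $ i - A / real M)\<^sup>2)
          = (\<Sum>i<M. A / real M * (v $ i - A / real M))"
        unfolding sum_subtractf[symmetric] by (intro sum.cong) (auto simp: algebra_simps power2_eq_square)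
      also have "\<dots> = 0" using M0 unfolding sum_distrib_left[symmetric] by (simp add: sum_subtractf A_def)
      finally show ?thesis by simp
    qed
    finally show ?thesis by (simp add: A_def power2_eq_square)
  qed
  have pos: "0 \<le> s / (real M * (real M - 1))" using s M0 by simp
  show ?thesis
    unfolding gossip_matrix_def
  proof (intro conjI ballI allI impI)
    show "?W \<in> carrier_mat M M" by fact
    show "transpose_mat ?W = ?W"
      by (rule eq_matI) (auto simp: hub_mat_def mult.commute)
    show "0 \<le> v \<bullet> (?W *\<^sub>v v)" if "v \<in> carrier_vec M" for v
      unfolding form[OF that] by (intro add_nonneg_nonneg sum_nonneg mult_nonneg_nonneg[OF pos]) auto
    show "mat_kernel ?W = {v. \<exists>a. v = vec M (\<lambda>_. a)}"
    proof (intro equalityI subsetI)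
      fix v :: "real Matrix.vec" assume "v \<in> mat_kernel ?W"
      then have v: "v \<in> carrier_vec M" "?W *\<^sub>v v = 0\<^sub>v M"
        using W by (auto simp: mat_kernel_def hub_mat_def)
      then have "v \<bullet> (?W *\<^sub>v v) = 0" by simp
      then have "(\<Sum>i<M. (v $ i - (\<Sum>k<M. v $ k) / real M)\<^sup>2) +
          s / (real M * (real M - 1)) * (real M * v $ c - (\<Sum>k<M. v $ k))\<^sup>2 = 0"
        using form[OF v(1)] by simp
      then have "(\<Sum>i<M. (v $ i - (\<Sum>k<M. v $ k) / real M)\<^sup>2) = 0"
        by (subst (asm) add_nonneg_eq_0_iff) (auto intro: sum_nonneg mult_nonneg_nonneg[OF pos] simp del: times_divide_eq_left)
      moreover define A where "A = (\<Sum>k<M. v $ k) / real M"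
      ultimately have "(\<Sum>i<M. (v $ i - A)\<^sup>2) = 0" by simp
      then have "\<forall>i\<in>{..<M}. (v $ i - A)\<^sup>2 = 0"
        by (subst (asm) sum_nonneg_eq_0_iff) simp_all
      then have "v = vec M (\<lambda>_. A)"
        using v(1) by (intro eq_vecI) auto
      then show "v \<in> {v. \<exists>a. v = vec M (\<lambda>_. a)}" by blast
    next
      fix v :: "real Matrix.vec" assume "v \<in> {v. \<exists>a. v = vec M (\<lambda>_. a)}"
      then obtain a where v: "v = vec M (\<lambda>_. a)" by blast
      have "?W *\<^sub>v v = 0\<^sub>v M"
      proof (rule eq_vecI)
        fix i assume "i < dim_vec (0\<^sub>v M)"
        then have i: "i < M" by simp
        have "v \<in> carrier_vec M" by (simp add: v)
        from mv[OF this i] show "(?W *\<^sub>v v) $ i = 0\<^sub>v M $ i"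
          using i c M0 by (simp add: v)
      qed (simp add: hub_mat_def)
      then show "v \<in> mat_kernel ?W" using W by (auto simp: mat_kernel_def v)
    qed
    fix i j assume ij: "i < M" "j < M" "?W $$ (i, j) \<noteq> 0"
    show "i = j \<or> (i, j) \<in> E"
    proof (rule ccontr)
      assume "\<not> (i = j \<or> (i, j) \<in> E)"
      with E[OF ij(1,2)] have "i \<noteq> j" "s = real M - 1" "i \<noteq> c" "j \<noteq> c" by blast+
      \<comment> \<open>Between two non-central devices the rank-one term is \<open>1 / M\<close>
        for this \<open>s\<close> and cancels the entry \<open>- 1 / M\<close>.\<close>
      then have "?W $$ (i, j) = 0" using ij M0 by (simp add: hub_mat_def hub_vec_def)
      with ij show False by simp
    qed
  qed
qed

section \<open>The chain objective and its saddle points\<close>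

abbreviation coord :: "rvec \<Rightarrow> nat \<Rightarrow> real" where "coord \<equiv> Poly_Mapping.lookup"

text \<open>The inner product with y yields all couplings of the second kind, including the linear
  term in y_0: \<open>\<beta>\<close> acts as a virtual coordinate of x before x_0.
  \<open>shift_down\<close> is the adjoint of the linear part.\<close>

definition shift_up :: "nat \<Rightarrow> real \<Rightarrow> rvec \<Rightarrow> rvec"
  where "shift_up n \<beta> x = (\<Sum>i<n. Poly_Mapping.single (Suc i) (coord x i)) + Poly_Mapping.single 0 \<beta>"

definition shift_down :: "nat \<Rightarrow> rvec \<Rightarrow> rvec"
  where "shift_down n y = (\<Sum>i<n. Poly_Mapping.single i (coord y (Suc i)))"

lemma coord_shift_down: "coord (shift_down n y) i = (if i < n then coord y (Suc i) else 0)"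
  unfolding shift_down_def lookup_sum_single by auto

lemma coord_shift_up:
  "coord (shift_up n \<beta> x) i = (if i = 0 then \<beta> else if i \<le> n then coord x (i - 1) else 0)"
proof (cases i)
  case (Suc k)
  have "(\<Sum>j<n. if Suc j = Suc k then coord x j else 0) = (if k < n then coord x k else 0)"
    by (simp add: eq_commute)
  then show ?thesis unfolding shift_up_def lookup_add lookup_sum_single by (simp add: Suc lookup_single Suc_le_eq)
qed (unfold shift_up_def lookup_add lookup_sum_single, simp)

lemma shift_up_euclid: "shift_up n \<beta> x \<in> euclid (Suc n)"
  by (auto simp: euclid_iff coord_shift_up)

lemma shift_down_euclid: "shift_down n y \<in> euclid (Suc n)"
  by (auto simp: euclid_iff coord_shift_down)

lemma inner_shift_up:
  "inner (shift_up n \<beta> x) y = (\<Sum>i<n. coord x i * coord y (Suc i)) + \<beta> * coord y 0"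
proof -
  have *: "inner (Poly_Mapping.single i c) y = c * coord y i" for i and c :: real
    by (subst inner_poly_mapping_superset[of "{i}"]) (auto simp: lookup_single)
  show ?thesis by (simp add: shift_up_def inner_add_left inner_sum_left *)
qed

lemma inner_shift_down: "inner (shift_down n y) x = (\<Sum>i<n. coord x i * coord y (Suc i))"
proof -
  have *: "inner (Poly_Mapping.single i c) x = c * coord x i" for i and c :: real
    by (subst inner_poly_mapping_superset[of "{i}"]) (auto simp: lookup_single)
  show ?thesis by (simp add: shift_down_def inner_sum_left * mult.commute)
qed

text \<open>Separate weights \<open>p\<close> and \<open>q\<close> let a device hold couplings of
  one kind only.\<close>

definition chain_obj :: "nat \<Rightarrow> real \<Rightarrow> real \<Rightarrow> real \<Rightarrow> real \<Rightarrow> objective"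
  where "chain_obj n \<beta> p q \<mu> z = p * inner (fst z) (snd z) - q * inner (shift_up n \<beta> (fst z)) (snd z)
    + \<mu> / 2 * (inner (fst z) (fst z) - inner (snd z) (snd z))"

definition chain_grad :: "nat \<Rightarrow> real \<Rightarrow> real \<Rightarrow> real \<Rightarrow> real \<Rightarrow> rvec \<times> rvec \<Rightarrow> rvec \<times> rvec"
  where "chain_grad n \<beta> p q \<mu> z =
    (p *\<^sub>R snd z - q *\<^sub>R shift_down n (snd z) + \<mu> *\<^sub>R fst z,
     p *\<^sub>R fst z - q *\<^sub>R shift_up n \<beta> (fst z) - \<mu> *\<^sub>R snd z)"

lemma coord_has_derivative [derivative_intros]:
  assumes "(g has_derivative g') F"
  shows "((\<lambda>z. coord (g z) i) has_derivative (\<lambda>h. coord (g' h) i)) F"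
  unfolding lookup_eq_inner using assms by (rule has_derivative_inner_left)

lemma chain_obj_has_derivative:
  "(chain_obj n \<beta> p q \<mu> has_derivative (\<lambda>h. inner (chain_grad n \<beta> p q \<mu> z) h)) (at z within S)"
proof -
  have "((\<lambda>z. p * inner (fst z) (snd z) -
      q * ((\<Sum>i<n. coord (fst z) i * coord (snd z) (Suc i)) + \<beta> * coord (snd z) 0)
    + \<mu> / 2 * (inner (fst z) (fst z) - inner (snd z) (snd z))) has_derivative
   (\<lambda>h. p * (inner (fst z) (snd h) + inner (fst h) (snd z)) -
      q * ((\<Sum>i<n. coord (fst z) i * coord (snd h) (Suc i) + coord (fst h) i * coord (snd z) (Suc i))
          + \<beta> * coord (snd h) 0)
    + \<mu> / 2 * (2 * inner (fst z) (fst h) - 2 * inner (snd z) (snd h)))) (at z within S)"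
    by (auto intro!: derivative_eq_intros simp: inner_commute)
  moreover have "inner (chain_grad n \<beta> p q \<mu> z) h =
      p * (inner (fst z) (snd h) + inner (fst h) (snd z)) -
      q * ((\<Sum>i<n. coord (fst z) i * coord (snd h) (Suc i) + coord (fst h) i * coord (snd z) (Suc i))
          + \<beta> * coord (snd h) 0)
    + \<mu> / 2 * (2 * inner (fst z) (fst h) - 2 * inner (snd z) (snd h))" for h
    unfolding chain_grad_def
    by (simp add: inner_prod_def inner_add_left inner_diff_left inner_shift_up inner_shift_down
      inner_commute[of "snd z" "fst h"] sum.distrib algebra_simps)
  ultimately show ?thesis
    unfolding chain_obj_def inner_shift_up by simp
qed

lemma chain_obj_differentiable: "chain_obj n \<beta> p q \<mu> differentiable_on S"
  unfolding differentiable_on_def differentiable_def using chain_obj_has_derivative by blast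

abbreviation amb :: "nat \<Rightarrow> (rvec \<times> rvec) set" where "amb n \<equiv> ambient (Suc n) (Suc n)"

lemma grad_chain_obj:
  assumes "z \<in> amb n"
  shows "grad (amb n) (chain_obj n \<beta> p q \<mu>) z = chain_grad n \<beta> p q \<mu> z"
proof (rule grad_eqI[OF subspace_ambient assms _ chain_obj_has_derivative])
  show "chain_grad n \<beta> p q \<mu> z \<in> amb n"
    using assms unfolding chain_grad_def ambient_def
    by (auto intro!: subspace_add subspace_diff subspace_scale subspace_euclid shift_up_euclid shift_down_euclid)
qed

lemma average_chain_obj:
  "average M (\<lambda>m. chain_obj n \<beta> (p m) (q m) \<mu>) =
    chain_obj n \<beta> ((\<Sum>m<M. p m) / real M) ((\<Sum>m<M. q m) / real M) (if M = 0 then 0 else \<mu>)"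
  by (auto simp: average_def chain_obj_def fun_eq_iff sum.distrib sum_subtractf
    sum_distrib_right[symmetric] add_divide_distrib diff_divide_distrib)

lemma regularized_chain_obj:
  "regularized \<epsilon> D (0, 0) (chain_obj n \<beta> p q \<mu>) = chain_obj n \<beta> p q (\<mu> + \<epsilon> / (2 * D\<^sup>2))"
  by (auto simp: regularized_def chain_obj_def fun_eq_iff power2_norm_eq_inner algebra_simps add_divide_distrib diff_divide_distrib)

section \<open>Monotonicity and smoothness of the bilinear chain\<close>

lemma shift_up_diff: "shift_up n \<beta> x - shift_up n \<beta> x' = shift_up n 0 (x - x')"
  by (rule poly_mapping_eqI) (simp add: coord_shift_up lookup_minus)

lemma shift_down_diff: "shift_down n y - shift_down n y' = shift_down n (y - y')"
  by (rule poly_mapping_eqI) (simp add: coord_shift_down lookup_minus)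

lemma norm_shift_down_le:
  assumes "y \<in> euclid (Suc n)"
  shows "norm (shift_down n y) \<le> norm y"
proof (rule power2_le_imp_le)
  have "(norm (shift_down n y))\<^sup>2 = (\<Sum>i<n. (coord y (Suc i))\<^sup>2)"
    by (simp add: euclid_norm_sq[OF shift_down_euclid] coord_shift_down)
  also have "\<dots> \<le> (\<Sum>i<Suc n. (coord y i)\<^sup>2)"
    by (subst sum.lessThan_Suc_shift) simp
  also have "\<dots> = (norm y)\<^sup>2" using assms by (simp only: euclid_norm_sq)
  finally show "(norm (shift_down n y))\<^sup>2 \<le> (norm y)\<^sup>2" .
qed simp

lemma norm_shift_up_le:
  assumes "x \<in> euclid (Suc n)"
  shows "norm (shift_up n 0 x) \<le> norm x"
proof (rule power2_le_imp_le)
  have "(norm (shift_up n 0 x))\<^sup>2 = (\<Sum>i<n. (coord x i)\<^sup>2)"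
    unfolding euclid_norm_sq[OF shift_up_euclid] by (subst sum.lessThan_Suc_shift) (simp add: coord_shift_up)
  also have "\<dots> \<le> (\<Sum>i<Suc n. (coord x i)\<^sup>2)" by simp
  also have "\<dots> = (norm x)\<^sup>2" using assms by (simp only: euclid_norm_sq)
  finally show "(norm (shift_up n 0 x))\<^sup>2 \<le> (norm x)\<^sup>2" .
qed simp

text \<open>The linear part of the saddle operator is skew, hence monotone with equality. Shifts do
  not increase norms, so its Lipschitz constant is at most \<open>2 * a = L\<close>.\<close>

lemma chain_obj_convex_concave_smooth:
  assumes a: "0 \<le> a" "a = L / 2"
  shows "convex_concave (amb n) (amb n) (chain_obj n \<beta> a a 0)"
    and "L_smooth (amb n) (amb n) L (chain_obj n \<beta> a a 0)"
proof -
  let ?f = "chain_obj n \<beta> a a 0"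
  let ?G = "saddle_operator (amb n) ?f"
  have diff: "?G z1 - ?G z2 = a *\<^sub>R (dy - shift_down n dy, shift_up n 0 dx - dx)"
    if "z1 \<in> amb n" "z2 \<in> amb n" and "dx = fst z1 - fst z2" "dy = snd z1 - snd z2" for z1 z2 dx dy
    using that(1,2) unfolding that(3,4) shift_up_diff[symmetric, where \<beta> = \<beta>] shift_down_diff[symmetric]
    by (simp add: saddle_operator_def grad_chain_obj chain_grad_def prod_eq_iff algebra_simps)
  show "convex_concave (amb n) (amb n) ?f"
    unfolding strongly_convex_concave_def
  proof (intro conjI ballI chain_obj_differentiable)
    fix z1 z2 assume z: "z1 \<in> amb n" "z2 \<in> amb n"
    have "inner (?G z1 - ?G z2) (z1 - z2) = 0"
      unfolding diff[OF z refl refl]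
      by (simp add: inner_prod_def inner_diff_left inner_shift_up inner_shift_down) (simp add: inner_commute algebra_simps)
    then show "0 * (norm (z1 - z2))\<^sup>2 \<le> inner (?G z1 - ?G z2) (z1 - z2)" by simp
  qed
  show "L_smooth (amb n) (amb n) L ?f"
    unfolding L_smooth_def
  proof (intro conjI ballI chain_obj_differentiable)
    fix z1 z2 assume z: "z1 \<in> amb n" "z2 \<in> amb n"
    define dx dy where "dx = fst z1 - fst z2" and "dy = snd z1 - snd z2"
    have eu: "dx \<in> euclid (Suc n)" "dy \<in> euclid (Suc n)"
      using z by (auto simp: dx_def dy_def ambient_def subspace_diff subspace_euclid)
    have "norm (dy - shift_down n dy, shift_up n 0 dx - dx) \<le> norm (2 * norm dy, 2 * norm dx)"
      unfolding norm_prod_def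
    proof (intro real_sqrt_le_mono add_mono power_mono)
      show "norm (fst (dy - shift_down n dy, shift_up n 0 dx - dx)) \<le> norm (fst (2 * norm dy, 2 * norm dx))"
        using norm_triangle_ineq4[of dy "shift_down n dy"] norm_shift_down_le[OF eu(2)] by simp
      show "norm (snd (dy - shift_down n dy, shift_up n 0 dx - dx)) \<le> norm (snd (2 * norm dy, 2 * norm dx))"
        using norm_triangle_ineq4[of "shift_up n 0 dx" dx] norm_shift_up_le[OF eu(1)] by simp
    qed auto
    also have "(2 * norm dy, 2 * norm dx) = 2 *\<^sub>R (norm dy, norm dx)" by simp
    also have "norm \<dots> = 2 * norm (z1 - z2)"
      by (simp only: norm_scaleR) (simp add: norm_prod_def dx_def dy_def add.commute)
    finally have "a * norm (dy - shift_down n dy, shift_up n 0 dx - dx) \<le> a * (2 * norm (z1 - z2))"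
      using a(1) by (rule mult_left_mono)
    moreover have "a * (2 * norm (z1 - z2)) = L * norm (z1 - z2)" using a(2) by simp
    ultimately show "norm (?G z1 - ?G z2) \<le> L * norm (z1 - z2)"
      unfolding diff[OF z dx_def dy_def] norm_scaleR abs_of_nonneg[OF a(1)] by (simp only:)
  qed
qed

section \<open>Saddle points of the chain on balls\<close>

lemma inner_shift_down_diff:
  "inner (shift_down n y) (x' - x) = inner (shift_up n \<beta> x') y - inner (shift_up n \<beta> x) y"
  by (simp add: inner_shift_up inner_shift_down lookup_minus sum_subtractf algebra_simps)

text \<open>The objective is quadratic in x, so the second-order expansion is exact. At a stationary
  point only the square remains, which serves both existence and uniqueness of saddle
  points.\<close>

lemma chain_obj_diff_fst:
  "chain_obj n \<beta> p q \<mu> (x', y) - chain_obj n \<beta> p q \<mu> (x, y) =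
    inner (fst (chain_grad n \<beta> p q \<mu> (x, y))) (x' - x) + \<mu> / 2 * (norm (x' - x))\<^sup>2"
proof -
  have "inner (fst (chain_grad n \<beta> p q \<mu> (x, y))) (x' - x) =
      p * inner y (x' - x) - q * inner (shift_down n y) (x' - x) + \<mu> * inner x (x' - x)"
    by (simp add: chain_grad_def inner_add_left inner_diff_left)
  then show ?thesis
    unfolding chain_obj_def inner_shift_down_diff[where \<beta> = \<beta>] power2_norm_eq_inner
    by (simp add: inner_diff_left inner_diff_right inner_commute[of y x] inner_commute[of y x'] inner_commute[of x' x] algebra_simps)
qed

lemma chain_obj_diff_snd:
  "chain_obj n \<beta> p q \<mu> (x, y') - chain_obj n \<beta> p q \<mu> (x, y) =
    inner (snd (chain_grad n \<beta> p q \<mu> (x, y))) (y' - y) - \<mu> / 2 * (norm (y' - y))\<^sup>2"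
  unfolding chain_obj_def chain_grad_def power2_norm_eq_inner
  by (simp add: inner_add_left inner_diff_left inner_diff_right inner_commute algebra_simps)

lemma chain_saddle_point:
  assumes \<mu>: "0 \<le> \<mu>" and z: "z \<in> X \<times> Y" "chain_grad n \<beta> p q \<mu> z = 0"
  shows "saddle_point X Y (chain_obj n \<beta> p q \<mu>) z"
  unfolding saddle_point_def
proof (intro conjI ballI)
  fix x y
  have *: "0 \<le> \<mu> / 2 * r\<^sup>2" for r :: real using \<mu> by simp
  show "chain_obj n \<beta> p q \<mu> (fst z, y) \<le> chain_obj n \<beta> p q \<mu> z"
    using chain_obj_diff_snd[of n \<beta> p q \<mu> "fst z" y "snd z"] z(2) *[of "norm (y - snd z)"] by simp
  show "chain_obj n \<beta> p q \<mu> z \<le> chain_obj n \<beta> p q \<mu> (x, snd z)"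
    using chain_obj_diff_fst[of n \<beta> p q \<mu> x "snd z" "fst z"] z(2) *[of "norm (x - fst z)"] by simp
qed fact

definition half_ball :: "nat \<Rightarrow> real \<Rightarrow> rvec set"
  where "half_ball N D = cball 0 (D / 2) \<inter> euclid N"

lemma half_ball_convex_body:
  assumes "0 < N" "0 < D"
  shows "convex_body N D (half_ball N D)"
proof -
  let ?X = "half_ball N D"
  have norm_single: "norm (Poly_Mapping.single 0 c :: rvec) = \<bar>c\<bar>" for c :: real
  proof -
    have "(norm (Poly_Mapping.single 0 c :: rvec))\<^sup>2 = \<bar>c\<bar>\<^sup>2"
      using euclid_norm_sq[OF single_in_euclid[of 0 1 c]] by (simp add: lookup_single)
    then show ?thesis by (simp only: power2_eq_iff_nonneg norm_ge_zero abs_ge_zero)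
  qed
  have b: "bounded ?X" by (simp add: half_ball_def bounded_Int)
  let ?u = "Poly_Mapping.single 0 (D / 2)" and ?v = "Poly_Mapping.single 0 (- D / 2)"
  have uv: "?u \<in> ?X" "?v \<in> ?X"
    using assms by (auto simp: half_ball_def single_in_euclid norm_single)
  have "diameter ?X \<le> D"
  proof (rule diameter_le)
    show "norm (x - y) \<le> D" if "x \<in> ?X" "y \<in> ?X" for x y
      using that norm_triangle_ineq4[of x y] by (simp add: half_ball_def)
  qed (use assms in auto)
  moreover have "D \<le> diameter ?X"
  proof -
    have "(?u :: rvec) - ?v = Poly_Mapping.single 0 D" by (simp add: single_diff[symmetric])
    then have "dist (?u :: rvec) ?v = D" unfolding dist_norm using assms by (simp only: norm_single abs_of_pos)
    then show ?thesis using diameter_bounded_bound[OF b uv] by simp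
  qed
  ultimately show ?thesis
    unfolding convex_body_def
  proof (intro conjI)
    show "convex ?X"
      unfolding half_ball_def by (intro convex_Int convex_cball subspace_imp_convex[OF subspace_euclid])
  qed (use b uv in \<open>auto simp: half_ball_def\<close>)
qed

text \<open>The shift puts 0 in front and each further coordinate copies its predecessor.\<close>

lemma shift_fixpoint_eq_0:
  assumes "x \<in> euclid (Suc n)" "x = shift_up n 0 x"
  shows "x = 0"
proof (rule poly_mapping_eqI)
  fix i show "coord x i = coord 0 i"
  proof (induction i)
    case 0
    then show ?case by (subst assms(2)) (simp add: coord_shift_up)
  next
    case (Suc i)
    then show ?case by (subst assms(2)) (simp add: coord_shift_up)
  qed
qed

text \<open>
  The \<open>x\<close>-part of a saddle point is unique: by strong convexity when \<open>\<mu> > 0\<close>. When \<open>\<mu> = 0\<close>, the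
  value of the game is \<open>0\<close> and \<open>y\<close> may be chosen in the direction of the \<open>y\<close>-gradient at \<open>x\<close>.
\<close>

lemma chain_saddle_fst_unique:
  assumes a: "0 < a" and \<mu>: "0 \<le> \<mu>" and D: "0 < D"
    and zs: "zs \<in> half_ball (Suc n) D \<times> half_ball (Suc n) D" "chain_grad n \<beta> a a \<mu> zs = 0"
    and z: "saddle_point (half_ball (Suc n) D) (half_ball (Suc n) D) (chain_obj n \<beta> a a \<mu>) z"
  shows "fst z = fst zs"
proof -
  let ?f = "chain_obj n \<beta> a a \<mu>" and ?X = "half_ball (Suc n) D"
  obtain x y where zxy: "z = (x, y)" by (cases z)
  obtain xs ys where zsxy: "zs = (xs, ys)" by (cases zs)
  have mem: "x \<in> ?X" "y \<in> ?X" "xs \<in> ?X" "ys \<in> ?X"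
    using z zs by (auto simp: saddle_point_def zxy zsxy)
  have sp: "?f (x, y') \<le> ?f (x, y)" "?f (x, y) \<le> ?f (x', y)" if "x' \<in> ?X" "y' \<in> ?X" for x' y'
    using z that by (auto simp: saddle_point_def zxy)
  have f1: "?f (x, ys) - ?f (xs, ys) = \<mu> / 2 * (norm (x - xs))\<^sup>2"
    using zs(2) by (simp add: chain_obj_diff_fst zsxy)
  have f2: "?f (xs, y) - ?f (xs, ys) = - (\<mu> / 2 * (norm (y - ys))\<^sup>2)"
    using zs(2) by (simp add: chain_obj_diff_snd zsxy)
  show ?thesis
  proof (cases "\<mu> = 0")
    case False
    have "\<mu> / 2 * (norm (x - xs))\<^sup>2 + \<mu> / 2 * (norm (y - ys))\<^sup>2 \<le> 0"
      using f1 f2 sp(1)[OF mem(3,4)] sp(2)[OF mem(3,4)] by linarith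
    moreover have "0 \<le> \<mu> / 2 * (norm (x - xs))\<^sup>2" "0 \<le> \<mu> / 2 * (norm (y - ys))\<^sup>2" using \<mu> by auto
    ultimately have "\<mu> / 2 * (norm (x - xs))\<^sup>2 = 0" by linarith
    then show ?thesis using False by (simp add: zxy zsxy)
  next
    case True
    define g where "g = a *\<^sub>R x - a *\<^sub>R shift_up n \<beta> x"
    have f: "?f (x', y') = inner (a *\<^sub>R x' - a *\<^sub>R shift_up n \<beta> x') y'" for x' y'
      using True by (simp add: chain_obj_def inner_diff_left)
    have gs: "a *\<^sub>R xs - a *\<^sub>R shift_up n \<beta> xs = 0"
      using zs(2) True by (simp add: chain_grad_def zsxy prod_eq_iff)
    \<comment> \<open>The saddle inequalities chain to
      \<open>f (x, y') \<le> f (x, y) \<le> f (xs, y) = 0\<close>, the last by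
      \<open>gs\<close>.\<close>
    have g_le: "inner g y' \<le> 0" if "y' \<in> ?X" for y'
      using sp(1)[OF mem(1) that] sp(2)[OF mem(3) that] unfolding f gs by (simp add: g_def)
    have gE: "g \<in> euclid (Suc n)"
      unfolding g_def using mem by (intro subspace_diff subspace_scale subspace_euclid shift_up_euclid) (auto simp: half_ball_def)
    have "g = 0"
    proof (rule ccontr)
      assume "g \<noteq> 0"
      let ?y = "(D / 2 / norm g) *\<^sub>R g"
      have "?y \<in> ?X" using gE D \<open>g \<noteq> 0\<close> by (auto simp: half_ball_def intro!: subspace_scale subspace_euclid)
      from g_le[OF this] have "D / 2 / norm g * inner g g \<le> 0" by simp
      moreover have "0 < D / 2 / norm g * inner g g" using D \<open>g \<noteq> 0\<close> by (intro mult_pos_pos) auto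
      ultimately show False by linarith
    qed
    with gs have "a *\<^sub>R (x - xs) = a *\<^sub>R (shift_up n \<beta> x - shift_up n \<beta> xs)"
      unfolding g_def scaleR_diff_right by (metis diff_eq_diff_eq right_minus_eq)
    then have "x - xs = shift_up n 0 (x - xs)" using a by (simp add: shift_up_diff)
    moreover have "x - xs \<in> euclid (Suc n)"
      using mem by (intro subspace_diff subspace_euclid) (auto simp: half_ball_def)
    ultimately show ?thesis using shift_fixpoint_eq_0[of "x - xs" n] by (simp add: zxy zsxy)
  qed
qed

text \<open>
  Stationarity of the regularized chain is a two-term recursion that starts at the last coordinate,
  where \<open>y\<close> vanishes; with \<open>\<eta> = \<mu> / a\<close> the pairs below are \<open>(x, - y)\<close> read backwards, up to scaling.
\<close>

fun chain_rec :: "real \<Rightarrow> nat \<Rightarrow> real \<times> real"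
  where
    "chain_rec \<eta> 0 = (1, \<eta>)"
  | "chain_rec \<eta> (Suc j) = (let (p, q) = chain_rec \<eta> j; p' = p + \<eta> * q in (p', q + \<eta> * p'))"

text \<open>Growth stays linear up to this length: the old second component is at most 1, so the
  first gains at most \<open>\<eta>\<close> per step; the new first component is at most 2, so the
  second gains at most \<open>2 * \<eta>\<close>.\<close>

lemma chain_rec_bounds:
  assumes "0 \<le> \<eta>" "real j * \<eta> \<le> 1 / 2"
  shows "1 \<le> fst (chain_rec \<eta> j) \<and> fst (chain_rec \<eta> j) \<le> 1 + real j * \<eta> \<and>
    0 \<le> snd (chain_rec \<eta> j) \<and> snd (chain_rec \<eta> j) \<le> 2 * real (Suc j) * \<eta>"
  using assms(2)
proof (induction j)
  case (Suc j)
  obtain p q where pq: "chain_rec \<eta> j = (p, q)" by (cases "chain_rec \<eta> j")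
  define A where "A = real j * \<eta>"
  have A: "A + \<eta> \<le> 1 / 2" using Suc.prems by (simp add: A_def algebra_simps)
  with Suc.IH pq assms(1) have IH: "1 \<le> p" "p \<le> 1 + A" "0 \<le> q" "q \<le> 2 * A + 2 * \<eta>"
    by (auto simp: A_def algebra_simps)
  have "q \<le> 1" using IH(4) A by simp
  then have *: "\<eta> * q \<le> \<eta>" using mult_left_mono[of q 1 \<eta>] assms(1) by simp
  have **: "0 \<le> \<eta> * q" using assms(1) IH by simp
  have "p + \<eta> * q \<le> 2" using * IH A by linarith
  then have le: "\<eta> * (p + \<eta> * q) \<le> \<eta> * 2" using assms(1) by (intro mult_left_mono)
  have nonneg: "0 \<le> \<eta> * (p + \<eta> * q)" using assms(1) IH ** by (intro mult_nonneg_nonneg) auto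
  have "1 \<le> p + \<eta> * q" "p + \<eta> * q \<le> 1 + A + \<eta>" "0 \<le> q + \<eta> * (p + \<eta> * q)"
    "q + \<eta> * (p + \<eta> * q) \<le> 2 * A + 4 * \<eta>"
    using IH * ** le nonneg by linarith+
  moreover have "1 + real (Suc j) * \<eta> = 1 + A + \<eta>" "2 * real (Suc (Suc j)) * \<eta> = 2 * A + 4 * \<eta>"
    by (simp_all add: A_def algebra_simps)
  ultimately show ?case
    unfolding chain_rec.simps pq Let_def prod.case fst_conv snd_conv by (simp only:)
qed (use assms in auto)

text \<open>The lower bound \<open>\<beta> / 2\<close> is what makes every undiscovered coordinate
  of x costly; the upper bounds keep the point inside the ball.\<close>

lemma chain_stationary_exists:
  assumes a: "0 < a" and \<mu>: "0 \<le> \<mu>" "2 * real (Suc n) * \<mu> \<le> a" and \<beta>: "0 \<le> \<beta>"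
  shows "\<exists>x\<in>euclid (Suc n). \<exists>y\<in>euclid (Suc n). chain_grad n \<beta> a a \<mu> (x, y) = 0 \<and>
    (\<forall>i\<le>n. \<beta> / 2 \<le> coord x i \<and> coord x i \<le> \<beta> \<and> \<bar>coord y i\<bar> \<le> \<beta>)"
proof -
  define \<eta> where "\<eta> = \<mu> / a"
  have \<eta>: "0 \<le> \<eta>" "real (Suc n) * \<eta> \<le> 1 / 2" "\<mu> = a * \<eta>"
    using a \<mu> by (auto simp: \<eta>_def field_simps)
  define p q where "p j = fst (chain_rec \<eta> j)" and "q j = snd (chain_rec \<eta> j)" for j
  have rec: "p (Suc j) = p j + \<eta> * q j" "q (Suc j) = q j + \<eta> * p (Suc j)" for j
    by (auto simp: p_def q_def Let_def split: prod.split)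
  have init: "q 0 = \<eta> * p 0" by (simp add: p_def q_def)
  have bd: "1 \<le> p j" "p j \<le> 2" "0 \<le> q j" "q j \<le> 2 * real (Suc j) * \<eta>" if "j \<le> Suc n" for j
  proof -
    have "real j * \<eta> \<le> real (Suc n) * \<eta>" using that \<eta>(1) by (intro mult_right_mono) auto
    then have *: "real j * \<eta> \<le> 1 / 2" using \<eta>(2) by linarith
    from chain_rec_bounds[OF \<eta>(1) this] * show "1 \<le> p j" "p j \<le> 2" "0 \<le> q j" "q j \<le> 2 * real (Suc j) * \<eta>"
      by (auto simp: p_def q_def)
  qed
  have mono: "p j \<le> p (Suc n)" if "j \<le> Suc n" for j
    using that
  proof (induction j rule: inc_induct)
    case (step k)
    then have "0 \<le> \<eta> * q k" using bd(3)[of k] \<eta>(1) by simp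
    with step show ?case using rec(1)[of k] by simp
  qed simp
  have q1: "q j \<le> 1" if "j \<le> n" for j
  proof -
    have "real (Suc j) * \<eta> \<le> real (Suc n) * \<eta>" using that \<eta>(1) by (intro mult_right_mono) auto
    then show ?thesis using bd(4)[of j] that \<eta>(2) by (simp add: algebra_simps)
  qed
  \<comment> \<open>One recursion step beyond x_0 must produce the virtual coordinate
    \<open>\<beta>\<close>; this is the stationarity equation at y_0. Since \<open>p\<close> stays
    between 1 and 2, so does the divisor.\<close>
  define s where "s = \<beta> / p (Suc n)"
  have P: "1 \<le> p (Suc n)" "p (Suc n) \<le> 2" using bd by auto
  have s: "0 \<le> s" "\<beta> / 2 \<le> s" "s \<le> \<beta>" "s * p (Suc n) = \<beta>"
  proof -
    show "0 \<le> s" "s * p (Suc n) = \<beta>" using P \<beta> by (auto simp: s_def)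
    show "\<beta> / 2 \<le> s" unfolding s_def using P \<beta> by (intro divide_left_mono) auto
    have "\<beta> / p (Suc n) \<le> \<beta> / 1" using P \<beta> by (intro divide_left_mono) auto
    then show "s \<le> \<beta>" by (simp add: s_def)
  qed
  define x where "x = (\<Sum>i<Suc n. Poly_Mapping.single i (s * p (n - i)))"
  define y where "y = (\<Sum>i<Suc n. Poly_Mapping.single i (- s * q (n - i)))"
  have cx: "coord x i = (if i \<le> n then s * p (n - i) else 0)" for i
    unfolding x_def lookup_sum_single by (subst sum.delta) auto
  have cy: "coord y i = (if i \<le> n then - s * q (n - i) else 0)" for i
    unfolding y_def lookup_sum_single by (subst sum.delta) auto
  have "a *\<^sub>R y - a *\<^sub>R shift_down n y + \<mu> *\<^sub>R x = 0"
  proof (rule poly_mapping_eqI)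
    fix i
    consider "i < n" | "i = n" | "n < i" by linarith
    then show "coord (a *\<^sub>R y - a *\<^sub>R shift_down n y + \<mu> *\<^sub>R x) i = coord 0 i"
    proof cases
      case 1
      then obtain k where k: "n - i = Suc k" "n - Suc i = k" by (metis Suc_diff_Suc)
      show ?thesis using 1 rec(2)[of k] unfolding lookup_add lookup_minus lookup_scaleR coord_shift_down
        by (simp add: cx cy k \<eta>(3) algebra_simps)
    next
      case 2
      then show ?thesis unfolding lookup_add lookup_minus lookup_scaleR coord_shift_down
        by (simp add: cx cy \<eta>(3) init algebra_simps)
    next
      case 3
      then show ?thesis unfolding lookup_add lookup_minus lookup_scaleR coord_shift_down by (simp add: cx cy)
    qed
  qed
  moreover have "a *\<^sub>R x - a *\<^sub>R shift_up n \<beta> x - \<mu> *\<^sub>R y = 0"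
  proof (rule poly_mapping_eqI)
    fix i
    consider "i = 0" | k where "i = Suc k" "i \<le> n" | "n < i" by (metis not_less not0_implies_Suc)
    then show "coord (a *\<^sub>R x - a *\<^sub>R shift_up n \<beta> x - \<mu> *\<^sub>R y) i = coord 0 i"
    proof cases
      case 1
      have "\<beta> = s * (p n + \<eta> * q n)" using s(4) rec(1)[of n] by simp
      then show ?thesis using 1 unfolding lookup_minus lookup_scaleR coord_shift_up
        by (simp add: cx cy \<eta>(3) algebra_simps)
    next
      case 2
      then have "n - k = Suc (n - i)" by simp
      then show ?thesis using 2 rec(1)[of "n - i"] unfolding lookup_minus lookup_scaleR coord_shift_up
        by (simp add: cx cy \<eta>(3) algebra_simps)
    next
      case 3
      then show ?thesis unfolding lookup_minus lookup_scaleR coord_shift_up by (simp add: cx cy)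
    qed
  qed
  moreover have "\<beta> / 2 \<le> coord x i \<and> coord x i \<le> \<beta> \<and> \<bar>coord y i\<bar> \<le> \<beta>" if "i \<le> n" for i
  proof -
    have b: "1 \<le> p (n - i)" "p (n - i) \<le> p (Suc n)" "0 \<le> q (n - i)" "q (n - i) \<le> 1"
      using bd[of "n - i"] mono[of "n - i"] q1[of "n - i"] by auto
    have "s * 1 \<le> s * p (n - i)" "s * p (n - i) \<le> s * p (Suc n)" "s * q (n - i) \<le> s * 1" "0 \<le> s * q (n - i)"
      using b s(1) by (intro mult_left_mono mult_nonneg_nonneg; simp)+
    then show ?thesis using that s by (simp add: cx cy abs_mult)
  qed
  moreover have "x \<in> euclid (Suc n)" "y \<in> euclid (Suc n)" by (auto simp: euclid_iff cx cy)
  ultimately show ?thesis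
    by (intro bexI[of _ x] bexI[of _ y]) (auto simp: chain_grad_def zero_prod_def)
qed

section \<open>Propagation of information\<close>

text \<open>Level \<open>j\<close>: only the first \<open>j\<close> coordinates in the order \<open>y\<^sub>0, x\<^sub>0, y\<^sub>1, x\<^sub>1, \<dots>\<close> may be nonzero.\<close>

definition level_x :: "nat \<Rightarrow> nat \<Rightarrow> rvec set"
  where "level_x n j = {x \<in> euclid (Suc n). \<forall>i. j \<le> 2 * i + 1 \<longrightarrow> coord x i = 0}"

definition level_y :: "nat \<Rightarrow> nat \<Rightarrow> rvec set"
  where "level_y n j = {y \<in> euclid (Suc n). \<forall>i. j \<le> 2 * i \<longrightarrow> coord y i = 0}"

lemma subspace_level: "subspace (level_x n j)" "subspace (level_y n j)"
  unfolding level_x_def level_y_def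
  by (rule subspaceI; simp add: euclid_iff lookup_add)+

lemma level_mono: "j \<le> j' \<Longrightarrow> level_x n j \<subseteq> level_x n j'" "j \<le> j' \<Longrightarrow> level_y n j \<subseteq> level_y n j'"
  by (auto simp: level_x_def level_y_def)

text \<open>In the chain order y_i has position 2i and x_i position 2i + 1. Couplings with weight
  \<open>p\<close> join 2i to 2i + 1 and can extend only a prefix of odd length; those with weight
  \<open>q\<close> join 2i + 1 to 2i + 2 and can extend only one of even length.\<close>

lemma chain_grad_level:
  assumes x: "x \<in> level_x n j" and y: "y \<in> level_y n j" and le: "j \<le> j'"
    and p: "p \<noteq> 0 \<Longrightarrow> odd j \<Longrightarrow> j < j'" and q: "q \<noteq> 0 \<Longrightarrow> even j \<Longrightarrow> j < j'"
  shows "fst (chain_grad n \<beta> p q \<mu> (x, y)) \<in> level_x n j'"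
    and "snd (chain_grad n \<beta> p q \<mu> (x, y)) \<in> level_y n j'"
proof -
  have eu: "x \<in> euclid (Suc n)" "y \<in> euclid (Suc n)" using x y by (auto simp: level_x_def level_y_def)
  have x0: "coord x i = 0" if "j \<le> 2 * i + 1" for i using x that by (simp add: level_x_def)
  have y0: "coord y i = 0" if "j \<le> 2 * i" for i using y that by (simp add: level_y_def)
  have "p * coord y i - q * coord (shift_down n y) i + \<mu> * coord x i = 0" if i: "j' \<le> 2 * i + 1" for i
  proof -
    have "p * coord y i = 0"
    proof (cases "p = 0")
      case False
      then have "j \<le> 2 * i" using p i le by (cases "even j") (auto elim!: evenE oddE)
      then show ?thesis by (simp add: y0)
    qed simp
    then show ?thesis using i le by (simp add: coord_shift_down x0 y0)
  qed
  moreover have "fst (chain_grad n \<beta> p q \<mu> (x, y)) \<in> euclid (Suc n)"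
    unfolding chain_grad_def fst_conv snd_conv
    by (intro subspace_add subspace_diff subspace_scale subspace_euclid shift_down_euclid eu)
  ultimately show "fst (chain_grad n \<beta> p q \<mu> (x, y)) \<in> level_x n j'"
    by (auto simp: level_x_def chain_grad_def lookup_add lookup_minus)
  have "p * coord x i - q * coord (shift_up n \<beta> x) i - \<mu> * coord y i = 0" if i: "j' \<le> 2 * i" for i
  proof -
    have "q * coord (shift_up n \<beta> x) i = 0"
    proof (cases "q = 0")
      case False
      \<comment> \<open>The constant \<open>\<beta>\<close> reveals y_0 from nothing, but level 0 is
        even, so a nonzero \<open>q\<close> forces \<open>j'\<close> to be positive.\<close>
      then have "0 < i" using q i le by (cases i) (auto intro: Nat.gr0I)
      then obtain k where k: "i = Suc k" by (cases i) auto
      then have "j \<le> 2 * k + 1" using q[OF False] i le by (cases "even j") (auto elim!: evenE oddE)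
      then show ?thesis by (simp add: coord_shift_up k x0)
    qed simp
    then show ?thesis using i le by (simp add: x0 y0)
  qed
  moreover have "snd (chain_grad n \<beta> p q \<mu> (x, y)) \<in> euclid (Suc n)"
    unfolding chain_grad_def fst_conv snd_conv
    by (intro subspace_add subspace_diff subspace_scale subspace_euclid shift_up_euclid eu)
  ultimately show "snd (chain_grad n \<beta> p q \<mu> (x, y)) \<in> level_y n j'"
    by (auto simp: level_y_def chain_grad_def lookup_minus)
qed

section \<open>Upper bounds for the levels along a run\<close>

definition levels :: "nat \<Rightarrow> nat \<Rightarrow> (nat \<Rightarrow> nat) \<Rightarrow> memories \<Rightarrow> memories \<Rightarrow> bool"
  where "levels M n l Mx My \<longleftrightarrow> (\<forall>m<M. Mx m \<subseteq> level_x n (l m) \<and> My m \<subseteq> level_y n (l m))"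

lemma levels_local_computation:
  assumes lc: "local_computation M (amb n) (\<lambda>m. chain_obj n \<beta> (p m) (q m) \<mu>) Mx My Mx' My'"
    and lv: "levels M n l Mx My"
    and le: "\<And>m. m < M \<Longrightarrow> l m \<le> l' m"
    and p: "\<And>m. m < M \<Longrightarrow> p m \<noteq> 0 \<Longrightarrow> odd (l m) \<Longrightarrow> l m < l' m"
    and q: "\<And>m. m < M \<Longrightarrow> q m \<noteq> 0 \<Longrightarrow> even (l m) \<Longrightarrow> l m < l' m"
  shows "levels M n l' Mx' My'"
  unfolding levels_def
proof (intro allI impI)
  fix m assume m: "m < M"
  let ?f = "chain_obj n \<beta> (p m) (q m) \<mu>"
  have Mem: "Mx m \<subseteq> level_x n (l m)" "My m \<subseteq> level_y n (l m)" using lv m by (auto simp: levels_def)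
  have Mem': "Mx m \<subseteq> level_x n (l' m)" "My m \<subseteq> level_y n (l' m)"
    using Mem level_mono[OF le[OF m]] by blast+
  have g: "fst (grad (amb n) ?f (x, y)) \<in> level_x n (l' m)" "snd (grad (amb n) ?f (x, y)) \<in> level_y n (l' m)"
    if "x \<in> Mx m" "y \<in> My m" for x y
  proof -
    have xy: "x \<in> level_x n (l m)" "y \<in> level_y n (l m)" using that Mem by auto
    then have "(x, y) \<in> amb n" by (auto simp: ambient_def level_x_def level_y_def)
    then show "fst (grad (amb n) ?f (x, y)) \<in> level_x n (l' m)" "snd (grad (amb n) ?f (x, y)) \<in> level_y n (l' m)"
      using chain_grad_level[OF xy le[OF m] p[OF m] q[OF m]] by (simp_all add: grad_chain_obj)
  qed
  obtain A B where AB: "Mx' m = Mx m \<union> A" "My' m = My m \<union> B"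
    and A: "\<forall>x\<in>A. \<exists>x'\<in>Mx m. \<exists>x''\<in>Mx m. \<exists>y''\<in>My m. x \<in> span {x', fst (grad (amb n) ?f (x'', y''))}"
    and B: "\<forall>y\<in>B. \<exists>y'\<in>My m. \<exists>x''\<in>Mx m. \<exists>y''\<in>My m. y \<in> span {y', snd (grad (amb n) ?f (x'', y''))}"
    using lc[unfolded local_computation_def, THEN spec, THEN mp, OF m] by (elim exE conjE) (rule that)
  have "A \<subseteq> level_x n (l' m)"
  proof
    fix x assume "x \<in> A"
    then obtain x' x'' y'' where *: "x' \<in> Mx m" "x'' \<in> Mx m" "y'' \<in> My m"
      "x \<in> span {x', fst (grad (amb n) ?f (x'', y''))}" using A by blast
    have "span {x', fst (grad (amb n) ?f (x'', y''))} \<subseteq> level_x n (l' m)"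
      by (rule span_minimal[OF _ subspace_level(1)]) (use * g(1)[of x'' y''] Mem'(1) in auto)
    then show "x \<in> level_x n (l' m)" using * by blast
  qed
  moreover have "B \<subseteq> level_y n (l' m)"
  proof
    fix y assume "y \<in> B"
    then obtain y' x'' y'' where *: "y' \<in> My m" "x'' \<in> Mx m" "y'' \<in> My m"
      "y \<in> span {y', snd (grad (amb n) ?f (x'', y''))}" using B by blast
    have "span {y', snd (grad (amb n) ?f (x'', y''))} \<subseteq> level_y n (l' m)"
      by (rule span_minimal[OF _ subspace_level(2)]) (use * g(2)[of x'' y''] Mem'(2) in auto)
    then show "y \<in> level_y n (l' m)" using * by blast
  qed
  ultimately show "Mx' m \<subseteq> level_x n (l' m) \<and> My' m \<subseteq> level_y n (l' m)" using AB Mem' by blast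
qed

text \<open>The condition on \<open>l\<close> includes \<open>i = m\<close>, so it covers both
  values of \<open>keep\<close>.\<close>

lemma levels_communicate:
  assumes E: "E \<subseteq> {..<M} \<times> {..<M}" and lv: "levels M n l Mx My"
    and le: "\<And>i m. m < M \<Longrightarrow> (i, m) \<in> E \<or> i = m \<Longrightarrow> l i \<le> l' m"
  shows "levels M n l' (communicate keep E Mx) (communicate keep E My)"
  unfolding levels_def communicate_def
proof (intro allI impI conjI)
  fix m assume m: "m < M"
  let ?I = "{i. (i, m) \<in> E \<or> keep \<and> i = m}"
  have "Mx i \<subseteq> level_x n (l' m)" "My i \<subseteq> level_y n (l' m)" if "i \<in> ?I" for i
  proof -
    have "l i \<le> l' m" "i < M" using that le[OF m, of i] E m by auto
    then show "Mx i \<subseteq> level_x n (l' m)" "My i \<subseteq> level_y n (l' m)"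
      using lv level_mono[of "l i" "l' m" n] unfolding levels_def by blast+
  qed
  then show "span (\<Union>i\<in>?I. Mx i) \<subseteq> level_x n (l' m)" "span (\<Union>i\<in>?I. My i) \<subseteq> level_y n (l' m)"
    by (intro span_minimal subspace_level; blast)+
qed

lemma levels_init: "levels M n l (\<lambda>_. {0}) (\<lambda>_. {0})"
  using subspace_0[OF subspace_level(1)] subspace_0[OF subspace_level(2)] by (simp add: levels_def)

text \<open>Communication is treated as free by granting all devices the same level. A local
  computation takes gradients only at points stored before it, hence gains at most one
  coordinate.\<close>

lemma run_levels_local:
  assumes "black_box_run keep M (amb n) (\<lambda>m. chain_obj n \<beta> (p m) (q m) \<mu>) E t k Mx My"
    and E: "\<And>t. E t \<subseteq> {..<M} \<times> {..<M}"
  shows "levels M n (\<lambda>_. k) Mx My"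
  using assms(1)
proof induction
  case init
  show ?case by (rule levels_init)
next
  case (local t k Mx My Mx' My')
  show ?case by (rule levels_local_computation[OF local.hyps(2) local.IH]) auto
next
  case (communication t k Mx My)
  show ?case by (rule levels_communicate[OF E communication.IH]) auto
qed

text \<open>Now local computations are free: with the assumed parities, no device can extend its own
  prefix, so the bound rises only through \<open>step\<close>. That is required only before
  \<open>T\<close>, as the network slows communication only up to then.\<close>

lemma run_levels_communication:
  assumes "black_box_run keep M (amb n) (\<lambda>m. chain_obj n \<beta> (p m) (q m) \<mu>) E t k Mx My"
    and "t \<le> T" and E: "\<And>t. E t \<subseteq> {..<M} \<times> {..<M}"
    and p: "\<And>m t. p m \<noteq> 0 \<Longrightarrow> even (l m t)" and q: "\<And>m t. q m \<noteq> 0 \<Longrightarrow> odd (l m t)"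
    and step: "\<And>i m t. t < T \<Longrightarrow> m < M \<Longrightarrow> (i, m) \<in> E t \<or> i = m \<Longrightarrow> l i t \<le> l m (Suc t)"
  shows "levels M n (\<lambda>m. l m t) Mx My"
  using assms(1,2)
proof induction
  case init
  show ?case by (rule levels_init)
next
  case (local t k Mx My Mx' My')
  show ?case
    by (rule levels_local_computation[OF local.hyps(2) local.IH]) (use local.prems p q in auto)
next
  case (communication t k Mx My)
  show ?case
    by (rule levels_communicate[OF E communication.IH]) (use communication.prems step in auto)
qed

text \<open>At least half of the coordinates of \<open>x\<close> vanish, and each of them costs at
  least \<open>(\<beta> / 2)\<^sup>2\<close>.\<close>

lemma level_x_far:
  assumes x: "x \<in> level_x n j" and j: "j \<le> n" and w: "w \<in> euclid (Suc n)"
    and \<beta>: "0 \<le> \<beta>" "\<And>i. i \<le> n \<Longrightarrow> \<beta> / 2 \<le> coord w i"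
  shows "real (Suc n) * \<beta>\<^sup>2 / 8 \<le> (norm (x - w))\<^sup>2"
proof -
  let ?h = "Suc n div 2"
  have xw: "x - w \<in> euclid (Suc n)" using x w by (auto simp: level_x_def intro: subspace_diff subspace_euclid)
  have "Suc n \<le> 2 * card {?h..<Suc n}" by simp
  then have "real (Suc n) \<le> 2 * real (card {?h..<Suc n})" by linarith
  then have "real (Suc n) * \<beta>\<^sup>2 / 8 \<le> 2 * real (card {?h..<Suc n}) * \<beta>\<^sup>2 / 8"
    by (intro divide_right_mono mult_right_mono) auto
  also have "\<dots> = (\<Sum>i\<in>{?h..<Suc n}. (\<beta> / 2)\<^sup>2)"
    by (simp add: power_divide)
  also have "\<dots> \<le> (\<Sum>i\<in>{?h..<Suc n}. (coord (x - w) i)\<^sup>2)"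
  proof (rule sum_mono)
    fix i assume i: "i \<in> {?h..<Suc n}"
    then have "j \<le> 2 * i + 1" using j by auto
    then have "coord x i = 0" using x by (simp add: level_x_def)
    then have "(coord (x - w) i)\<^sup>2 = (coord w i)\<^sup>2" by (simp add: lookup_minus)
    moreover have "(\<beta> / 2)\<^sup>2 \<le> (coord w i)\<^sup>2" using \<beta> i by (intro power_mono) auto
    ultimately show "(\<beta> / 2)\<^sup>2 \<le> (coord (x - w) i)\<^sup>2" by simp
  qed
  also have "\<dots> \<le> (\<Sum>i<Suc n. (coord (x - w) i)\<^sup>2)"
    by (rule sum_mono2) auto
  also have "\<dots> = (norm (x - w))\<^sup>2" using euclid_norm_sq[OF xw] by (simp only:)
  finally show ?thesis .
qed

text \<open>The value of \<open>\<beta>\<close> makes a vector with all coordinates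
  \<open>\<beta>\<close> have norm \<open>D / 2\<close>. The distance in \<open>level_x_far\<close>
  then becomes \<open>D\<^sup>2 / 32\<close>, so an accurate output has a level above
  \<open>n\<close>.\<close>

lemma chain_complexity:
  assumes a: "0 < a" and \<mu>: "0 \<le> \<mu>" "2 * real (Suc n) * \<mu> \<le> a" and D: "0 < D" "32 * e < D\<^sup>2"
    and M: "0 < M" and sums: "(\<Sum>m<M. p m) = a * real M" "(\<Sum>m<M. q m) = a * real M"
    and E: "\<And>t. E t \<subseteq> {..<M} \<times> {..<M}"
    and p: "\<And>m t. p m \<noteq> 0 \<Longrightarrow> even (l m t)" and q: "\<And>m t. q m \<noteq> 0 \<Longrightarrow> odd (l m t)"
    and step: "\<And>i m t. t < n * R \<Longrightarrow> m < M \<Longrightarrow> (i, m) \<in> E t \<or> i = m \<Longrightarrow> l i t \<le> l m (Suc t)"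
    and l: "\<And>m t. l m t \<le> t div R + 1"
  shows "complexity_at_least M (amb n) (half_ball (Suc n) D) (half_ball (Suc n) D)
    (\<lambda>m. chain_obj n (D / (2 * sqrt (real (Suc n)))) (p m) (q m) \<mu>) E e (real n * real R) (real (Suc n))"
proof -
  define \<beta> where "\<beta> = D / (2 * sqrt (real (Suc n)))"
  let ?X = "half_ball (Suc n) D" and ?fs = "\<lambda>m. chain_obj n \<beta> (p m) (q m) \<mu>"
  have \<beta>: "0 \<le> \<beta>" "real (Suc n) * \<beta>\<^sup>2 = (D / 2)\<^sup>2"
    using D by (simp_all add: \<beta>_def power_divide power_mult_distrib del: of_nat_Suc)
  have avg: "average M ?fs = chain_obj n \<beta> a a \<mu>"
    unfolding average_chain_obj sums using M by simp
  obtain xs ys where st: "xs \<in> euclid (Suc n)" "ys \<in> euclid (Suc n)" "chain_grad n \<beta> a a \<mu> (xs, ys) = 0"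
    and bd: "\<And>i. i \<le> n \<Longrightarrow> \<beta> / 2 \<le> coord xs i \<and> coord xs i \<le> \<beta> \<and> \<bar>coord ys i\<bar> \<le> \<beta>"
    using chain_stationary_exists[OF a \<mu> \<beta>(1)] by blast
  have ball: "v \<in> ?X" if v: "v \<in> euclid (Suc n)" "\<And>i. i \<le> n \<Longrightarrow> \<bar>coord v i\<bar> \<le> \<beta>" for v
  proof -
    have "(norm v)\<^sup>2 \<le> (\<Sum>i<Suc n. \<beta>\<^sup>2)"
      unfolding euclid_norm_sq[OF v(1)]
    proof (rule sum_mono)
      fix i assume "i \<in> {..<Suc n}"
      then have "\<bar>coord v i\<bar> \<le> \<beta>" using v(2) by simp
      then show "(coord v i)\<^sup>2 \<le> \<beta>\<^sup>2" by (simp add: abs_le_square_iff[symmetric] \<beta>(1))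
    qed
    also have "\<dots> = (D / 2)\<^sup>2" using \<beta>(2) by simp
    finally have "norm v \<le> D / 2" by (rule power2_le_imp_le) (use D in auto)
    then show ?thesis using v by (simp add: half_ball_def)
  qed
  have "xs \<in> ?X" by (rule ball[OF st(1)]) (use bd \<beta>(1) in fastforce)
  moreover have "ys \<in> ?X" by (rule ball[OF st(2)]) (use bd in blast)
  ultimately have zs: "(xs, ys) \<in> ?X \<times> ?X" by simp
  have far: "n < j" if x: "fst z \<in> level_x n j" and acc: "dist_accurate ?X ?X (average M ?fs) e z" for z j
  proof (rule ccontr)
    assume "\<not> n < j"
    obtain w where w: "saddle_point ?X ?X (chain_obj n \<beta> a a \<mu>) w" "(norm (z - w))\<^sup>2 \<le> e"
      using acc unfolding dist_accurate_def avg by blast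
    \<comment> \<open>Accuracy refers to some saddle point \<open>w\<close>, but all of them share
      the x-part.\<close>
    have "fst w = xs" using chain_saddle_fst_unique[OF a \<mu>(1) D(1) zs st(3) w(1)] by simp
    then have "norm (fst z - xs) \<le> norm (z - w)" using norm_fst_le[of "fst (z - w)" "snd (z - w)"] unfolding prod.collapse by simp
    from power_mono[OF this norm_ge_zero, of 2] w(2) have "(norm (fst z - xs))\<^sup>2 \<le> e" by linarith
    moreover have "real (Suc n) * \<beta>\<^sup>2 / 8 \<le> (norm (fst z - xs))\<^sup>2"
      using level_x_far[OF x _ st(1) \<beta>(1)] bd \<open>\<not> n < j\<close> by simp
    ultimately show False using \<beta>(2) D(2) by (simp add: power_divide)
  qed
  have out: "fst z \<in> level_x n j"
    if "levels M n l' Mx My" "\<And>m. l' m \<le> j" "fst z \<in> span (\<Union>m<M. Mx m)" for z :: "rvec \<times> rvec" and l' Mx My j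
  proof -
    have "span (\<Union>m<M. Mx m) \<subseteq> level_x n j"
      by (rule span_minimal[OF _ subspace_level(1)]) (use that(1,2) level_mono(1) in \<open>fastforce simp: levels_def\<close>)
    then show ?thesis using that(3) by blast
  qed
  have "complexity_at_least M (amb n) ?X ?X ?fs E e (real n * real R) (real (Suc n))"
    unfolding complexity_at_least_def
  proof (intro conjI allI impI)
    show "\<exists>zs. saddle_point ?X ?X (average M ?fs) zs"
      unfolding avg using chain_saddle_point[OF \<mu>(1) zs st(3)] by blast
    fix keep t k z
    assume bo: "black_box_output keep M (amb n) ?fs E t k z" and acc: "dist_accurate ?X ?X (average M ?fs) e z"
    obtain Mx My where run: "black_box_run keep M (amb n) ?fs E t k Mx My" and z: "fst z \<in> span (\<Union>m<M. Mx m)"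
      using bo unfolding black_box_output_def by blast
    have "n < k" by (rule far[OF out[OF run_levels_local[OF run E] _ z] acc]) simp
    then show "real (Suc n) \<le> real k" by simp
    have "n * R \<le> t"
    \<comment> \<open>The bound \<open>l\<close> is justified only up to round \<open>n * R\<close>,
      and later there is nothing to show. A level above \<open>n\<close> takes \<open>n\<close>
      completed phases, because \<open>l\<close> runs one ahead of the phase number.\<close>
    proof (cases "t \<le> n * R")
      case True
      have "n < t div R + 1"
        by (rule far[OF out[OF run_levels_communication[where l = l, OF run True E p q step] l z] acc])
      then have "n * R \<le> t div R * R" by (intro mult_right_mono) auto
      then show ?thesis using div_times_less_eq_dividend[of t R] by linarith
    qed simp
    then show "real n * real R \<le> real t" by (simp only: of_nat_mult[symmetric] of_nat_le_iff)
  qed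
  then show ?thesis by (simp only: \<beta>_def)
qed

section \<open>Time-varying stars\<close>

definition star_edges :: "nat \<Rightarrow> nat \<Rightarrow> (nat \<times> nat) set"
  where "star_edges M c = {(i, j). i < M \<and> j < M \<and> i \<noteq> j \<and> (i = c \<or> j = c)}"

definition complete_edges :: "nat \<Rightarrow> (nat \<times> nat) set"
  where "complete_edges M = {(i, j). i < M \<and> j < M \<and> i \<noteq> j}"

lemma connected_star:
  assumes "c < M"
  shows "connected_graph M (star_edges M c)"
proof -
  have "(i, c) \<in> (star_edges M c)\<^sup>*" "(c, i) \<in> (star_edges M c)\<^sup>*" if "i < M" for i
    using that assms by (cases "i = c"; auto simp: star_edges_def intro: r_into_rtrancl)+
  then have "(i, j) \<in> (star_edges M c)\<^sup>*" if "i < M" "j < M" for i j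
    using that rtrancl_trans by fast
  then show ?thesis
    by (auto simp: connected_graph_def star_edges_def sym_def irrefl_def)
qed

lemma connected_complete: "connected_graph M (complete_edges M)"
proof -
  have "(i, j) \<in> (complete_edges M)\<^sup>*" if "i < M" "j < M" for i j
    using that by (cases "i = j") (auto simp: complete_edges_def intro: r_into_rtrancl)
  then show ?thesis
    by (auto simp: connected_graph_def complete_edges_def sym_def irrefl_def)
qed

text \<open>
  Time is divided into phases of \<open>R\<close> rounds. In phase \<open>ph\<close> only one of the devices \<open>0\<close>, \<open>1\<close> and the
  earlier centres of the phase have advanced to level \<open>ph + 1\<close>.
\<close>

definition schedule :: "nat \<Rightarrow> nat \<Rightarrow> nat \<Rightarrow> nat"
  where "schedule R m t = t div R +
    of_bool (m = (if even (t div R) then 1 else 0) \<or> 2 \<le> m \<and> m < 2 + t mod R)"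

text \<open>Device 0 extends only odd levels and device 1 only even ones, so neither can advance by
  itself beyond the schedule.\<close>

lemma schedule_parity: "even (schedule R 0 t)" "odd (schedule R 1 t)"
  by (auto simp: schedule_def)

lemma schedule_bounds: "t div R \<le> schedule R m t" "schedule R m t \<le> t div R + 1"
  by (auto simp: schedule_def)

text \<open>The centre of round \<open>t\<close> is the first relay not yet counted as informed, so
  it passes on only the level of the phase; what it receives is credited to it from the next round
  on. The last round of a phase lifts every device to the next level. For \<open>R = 1\<close> every
  round is such a round and any graph is allowed.\<close>

lemma schedule_step:
  assumes R: "0 < R" and adj: "R = 1 \<or> i = m \<or> i = 2 + t mod R \<or> m = 2 + t mod R"
  shows "schedule R i t \<le> schedule R m (Suc t)"
proof (cases "Suc (t mod R) = R")
  case True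
  then have "Suc t div R = Suc (t div R)" by (simp add: div_Suc mod_Suc)
  then show ?thesis using schedule_bounds(1)[of "Suc t" R m] schedule_bounds(2)[of R i t] by simp
next
  case False
  then have "Suc t mod R = Suc (t mod R)" "Suc t div R = t div R" by (simp_all add: div_Suc mod_Suc)
  moreover have "R \<noteq> 1" using False by auto
  ultimately show ?thesis using adj by (auto simp: schedule_def)
qed

text \<open>A star on M vertices has condition number M, the largest integer up to
  \<open>\<kappa>\<close>; the hub matrix on the complete graph reaches \<open>\<kappa>\<close>
  itself from round \<open>T\<close> on. For \<open>\<kappa> < 3\<close> complete graphs on three
  devices suffice, as one round per transfer is enough up to constants. The factor 4 comes from
  \<open>M + 1 \<le> 4 * (M - 2)\<close> for \<open>M \<ge> 3\<close>.\<close>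

lemma star_network:
  fixes \<kappa> :: real
  assumes M: "M = (if 3 \<le> \<kappa> then nat \<lfloor>\<kappa>\<rfloor> else 3)" and \<kappa>: "1 \<le> \<kappa>"
    and E: "E = (\<lambda>t. if 3 \<le> \<kappa> \<and> t < T then star_edges M (2 + t mod (M - 2)) else complete_edges M)"
    and W: "W = (\<lambda>t. if 3 \<le> \<kappa> \<and> t < T then hub_mat M (2 + t mod (M - 2)) (real M - 1) else hub_mat M 0 (\<kappa> - 1))"
  shows "3 \<le> M" "\<kappa> \<le> 4 * real (M - 2)" "network M \<kappa> E W"
    "(i, m) \<in> E t \<Longrightarrow> t < T \<Longrightarrow> M - 2 = 1 \<or> i = 2 + t mod (M - 2) \<or> m = 2 + t mod (M - 2)"
proof -
  have M\<kappa>: "real M \<le> \<kappa> \<and> \<kappa> < real M + 1" if "3 \<le> \<kappa>"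
    using that M by simp
  show M3: "3 \<le> M" using M by (auto simp: le_nat_iff le_floor_iff)
  show "\<kappa> \<le> 4 * real (M - 2)"
  proof (cases "3 \<le> \<kappa>")
    case True
    have "3 \<le> real M" "real (M - 2) = real M - 2" using M3 by auto
    then show ?thesis using M\<kappa>[OF True] by linarith
  qed (simp add: M)
  have centre: "2 + t mod (M - 2) < M" for t
    using M3 mod_less_divisor[of "M - 2" t] by linarith
  have complete: "gossip_matrix M (complete_edges M) (hub_mat M 0 (\<kappa> - 1))"
    by (rule hub_mat_gossip) (use M3 \<kappa> in \<open>auto simp: complete_edges_def\<close>)
  have star: "gossip_matrix M (star_edges M c) (hub_mat M c (real M - 1))" if "c < M" for c
    by (rule hub_mat_gossip) (use M3 that in \<open>auto simp: star_edges_def\<close>)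
  have cond: "condition_number M (hub_mat M 0 (\<kappa> - 1)) = \<kappa>"
    "\<And>c. c < M \<Longrightarrow> condition_number M (hub_mat M c (real M - 1)) = real M"
    using M3 \<kappa> by (simp_all add: hub_mat_condition_number)
  show "network M \<kappa> E W"
    unfolding network_def
  proof (intro conjI allI)
    show "2 \<le> M" using M3 by simp
    show "connected_graph M (E t)" for t
      unfolding E using connected_star[OF centre[of t]] connected_complete by simp
    show "gossip_matrix M (E t) (W t)" for t
      unfolding E W using star[OF centre[of t]] complete by simp
    show "condition_number M (W t) \<le> \<kappa>" for t
      unfolding W using M\<kappa> cond(1) cond(2)[OF centre[of t]] by simp
    show "\<exists>t. condition_number M (W t) = \<kappa>"
      by (rule exI[of _ T]) (simp add: W cond)
  qed
  show "M - 2 = 1 \<or> i = 2 + t mod (M - 2) \<or> m = 2 + t mod (M - 2)" if "(i, m) \<in> E t" "t < T"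
    using that M by (auto simp: E star_edges_def split: if_splits)
qed

section \<open>Choice of the parameters\<close>

lemma complexity_at_least_mono:
  assumes "complexity_at_least M S X Y fs E e a b" "a' \<le> a" "b' \<le> b"
  shows "complexity_at_least M S X Y fs E e a' b'"
  using assms unfolding complexity_at_least_def by (meson order_trans)

lemma lower_bound_instance:
  fixes L D \<epsilon> \<kappa> :: real
  assumes pos: "0 < L" "0 < D" "0 < \<epsilon>" "1 \<le> \<kappa>" and \<epsilon>: "\<epsilon> \<le> 1 / 64 * D\<^sup>2" "\<epsilon> \<le> 1 / 64 * (L * D\<^sup>2)"
  shows "\<exists>M E W nx ny X Y fs.
           network M \<kappa> E W \<and>
           convex_body nx D X \<and> convex_body ny D Y \<and> 0 \<in> X \<and> 0 \<in> Y \<and>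
           (\<forall>m<M. fs m differentiable_on ambient nx ny) \<and>
           convex_concave (ambient nx ny) (ambient nx ny) (average M fs) \<and>
           L_smooth (ambient nx ny) (ambient nx ny) L (average M fs) \<and>
           complexity_at_least M (ambient nx ny) X Y fs E \<epsilon>
             (1 / 16 * (\<kappa> * (L * D\<^sup>2 / \<epsilon>))) (1 / 16 * (L * D\<^sup>2 / \<epsilon>)) \<and>
           complexity_at_least M (ambient nx ny) X Y (\<lambda>m. regularized \<epsilon> D (0, 0) (fs m)) E (\<epsilon> / 2)
             (1 / 16 * (\<kappa> * (L * D\<^sup>2 / \<epsilon>))) (1 / 16 * (L * D\<^sup>2 / \<epsilon>))"
proof -
  define u where "u = L * D\<^sup>2 / \<epsilon>"
  have u: "64 \<le> u" using \<epsilon>(2) pos by (simp add: u_def field_simps)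
  \<comment> \<open>\<open>Suc n\<close> is the largest length compatible with
    \<open>2 * real (Suc n) * \<mu> \<le> a\<close>, because
    \<open>a / (2 * \<mu>) = u / 2\<close>.\<close>
  define n where "n = nat \<lfloor>u / 2\<rfloor> - 1"
  have "real (nat \<lfloor>u / 2\<rfloor>) = of_int \<lfloor>u / 2\<rfloor>" using u by simp
  moreover have "1 \<le> nat \<lfloor>u / 2\<rfloor>" using u by (simp add: le_nat_iff le_floor_iff)
  ultimately have N: "real (Suc n) \<le> u / 2" "u / 4 \<le> real n"
    using u by (simp_all add: n_def of_nat_diff) linarith+
  define a \<mu> \<beta> where "a = L / 2" and "\<mu> = \<epsilon> / (2 * D\<^sup>2)" and "\<beta> = D / (2 * sqrt (real (Suc n)))"
  have a: "0 < a" and \<mu>: "0 \<le> \<mu>" using pos by (auto simp: a_def \<mu>_def)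
  have "2 * real (Suc n) * \<mu> \<le> 2 * (u / 2) * \<mu>" using N(1) \<mu> by (intro mult_right_mono) auto
  also have "\<dots> = a" using pos by (simp add: u_def \<mu>_def a_def field_simps)
  finally have \<mu>a: "2 * real (Suc n) * \<mu> \<le> a" .
  define M where "M = (if 3 \<le> \<kappa> then nat \<lfloor>\<kappa>\<rfloor> else 3)"
  define R where "R = M - 2"
  define E where "E = (\<lambda>t. if 3 \<le> \<kappa> \<and> t < n * R then star_edges M (2 + t mod (M - 2)) else complete_edges M)"
  define W where "W = (\<lambda>t. if 3 \<le> \<kappa> \<and> t < n * R then hub_mat M (2 + t mod (M - 2)) (real M - 1) else hub_mat M 0 (\<kappa> - 1))"
  note net = star_network[OF M_def pos(4) E_def W_def]
  \<comment> \<open>The factor \<open>real M\<close> compensates the division in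
    \<open>average\<close>, since only one device holds each kind of coupling.\<close>
  define p q where "p m = (if m = 0 then a * real M else 0)" and "q m = (if m = 1 then a * real M else 0)" for m :: nat
  have sums: "(\<Sum>m<M. p m) = a * real M" "(\<Sum>m<M. q m) = a * real M"
    using net(1) by (simp_all add: p_def q_def)
  let ?fs = "\<lambda>\<mu> m. chain_obj n \<beta> (p m) (q m) \<mu>" and ?X = "half_ball (Suc n) D"
  have R: "0 < R" using net(1) by (simp add: R_def)
  have compl: "complexity_at_least M (amb n) ?X ?X (?fs \<mu>') E e (1 / 16 * (\<kappa> * u)) (1 / 16 * u)"
    if "0 \<le> \<mu>'" "\<mu>' \<le> \<mu>" "e \<le> \<epsilon>" for \<mu>' e
  proof (rule complexity_at_least_mono)
    show "complexity_at_least M (amb n) ?X ?X (?fs \<mu>') E e (real n * real R) (real (Suc n))"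
      unfolding \<beta>_def
    proof (rule chain_complexity[where l = "schedule R", OF a that(1) _ pos(2) _ _ sums])
      have "2 * real (Suc n) * \<mu>' \<le> 2 * real (Suc n) * \<mu>" using that by (intro mult_left_mono) auto
      then show "2 * real (Suc n) * \<mu>' \<le> a" using \<mu>a by linarith
      have "0 < D\<^sup>2" using pos by simp
      then show "32 * e < D\<^sup>2" using \<epsilon>(1) that(3) by linarith
      show "0 < M" using net(1) by simp
      show "E t \<subseteq> {..<M} \<times> {..<M}" for t by (auto simp: E_def star_edges_def complete_edges_def)
      show "even (schedule R m t)" if "p m \<noteq> 0" for m t
        using that schedule_parity(1) by (simp add: p_def split: if_splits)
      show "odd (schedule R m t)" if "q m \<noteq> 0" for m t
        using that schedule_parity(2) by (simp add: q_def split: if_splits)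
      show "schedule R i t \<le> schedule R m (Suc t)" if "t < n * R" "(i, m) \<in> E t \<or> i = m" for i m t
        by (rule schedule_step[OF R]) (use net(4)[OF _ that(1)] that(2) in \<open>auto simp: R_def\<close>)
      show "schedule R m t \<le> t div R + 1" for m t by (rule schedule_bounds)
    qed
    \<comment> \<open>The origin of 1/16: a quarter of \<open>u\<close> from the rounding of
      \<open>n\<close>, a quarter of \<open>\<kappa>\<close> from the phase length
      \<open>R = M - 2\<close>.\<close>
    have "(u / 4) * (\<kappa> / 4) \<le> real n * real R"
      using N(2) u net(2) pos by (intro mult_mono) (auto simp: R_def)
    then show "1 / 16 * (\<kappa> * u) \<le> real n * real R" by (simp add: mult.commute)
    show "1 / 16 * u \<le> real (Suc n)" using N(2) u by simp
  qed
  have avg: "average M (?fs 0) = chain_obj n \<beta> a a 0"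
    unfolding average_chain_obj sums using net(1) by simp
  have reg: "(\<lambda>m. regularized \<epsilon> D (0, 0) (?fs 0 m)) = ?fs \<mu>"
    by (simp add: regularized_chain_obj \<mu>_def)
  have X: "convex_body (Suc n) D ?X" using pos by (intro half_ball_convex_body) auto
  have X0: "0 \<in> ?X" using pos subspace_0[OF subspace_euclid] by (simp add: half_ball_def)
  have aL: "0 \<le> a" "a = L / 2" using a by (simp_all add: a_def)
  show ?thesis
    unfolding u_def[symmetric]
  proof (intro exI conjI)
    show "network M \<kappa> E W" by (rule net)
    show "convex_concave (amb n) (amb n) (average M (?fs 0))"
      unfolding avg by (rule chain_obj_convex_concave_smooth(1)[OF aL])
    show "L_smooth (amb n) (amb n) L (average M (?fs 0))"
      unfolding avg by (rule chain_obj_convex_concave_smooth(2)[OF aL])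
    show "complexity_at_least M (amb n) ?X ?X (?fs 0) E \<epsilon> (1 / 16 * (\<kappa> * u)) (1 / 16 * u)"
      by (rule compl) (use \<mu> in auto)
    show "complexity_at_least M (amb n) ?X ?X (\<lambda>m. regularized \<epsilon> D (0, 0) (?fs 0 m)) E (\<epsilon> / 2)
        (1 / 16 * (\<kappa> * u)) (1 / 16 * u)"
      unfolding reg by (rule compl) (use \<mu> pos in auto)
  qed (auto simp: X X0 chain_obj_differentiable)
qed

theorem mainTheorem3:
  shows
    "(\<forall>nx ny X Y z0 f D \<epsilon>.
        0 < D \<and> 0 < \<epsilon> \<and> convex_body nx D X \<and> convex_body ny D Y \<and> z0 \<in> X \<times> Y \<and>
        convex_concave (ambient nx ny) (X \<times> Y) f \<longrightarrow>
        strongly_convex_concave (ambient nx ny) (X \<times> Y) (\<epsilon> / (2 * D\<^sup>2)) (regularized \<epsilon> D z0 f) \<and>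
        (\<forall>z. gap_accurate X Y (regularized \<epsilon> D z0 f) (\<epsilon> / 2) z \<longrightarrow> gap_accurate X Y f \<epsilon> z)) \<and>
     (\<exists>c>0. \<exists>\<delta>>0. \<forall>L D \<epsilon> \<kappa> :: real.
        0 < L \<and> 0 < D \<and> 0 < \<epsilon> \<and> \<epsilon> \<le> \<delta> * D\<^sup>2 \<and> \<epsilon> \<le> \<delta> * (L * D\<^sup>2) \<and> 1 \<le> \<kappa> \<longrightarrow>
        (\<exists>M E W nx ny X Y fs.
           network M \<kappa> E W \<and>
           convex_body nx D X \<and> convex_body ny D Y \<and> 0 \<in> X \<and> 0 \<in> Y \<and>
           (\<forall>m<M. fs m differentiable_on ambient nx ny) \<and>
           convex_concave (ambient nx ny) (ambient nx ny) (average M fs) \<and>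
           L_smooth (ambient nx ny) (ambient nx ny) L (average M fs) \<and>
           complexity_at_least M (ambient nx ny) X Y fs E \<epsilon>
             (c * (\<kappa> * (L * D\<^sup>2 / \<epsilon>))) (c * (L * D\<^sup>2 / \<epsilon>)) \<and>
           complexity_at_least M (ambient nx ny) X Y (\<lambda>m. regularized \<epsilon> D (0, 0) (fs m)) E (\<epsilon> / 2)
             (c * (\<kappa> * (L * D\<^sup>2 / \<epsilon>))) (c * (L * D\<^sup>2 / \<epsilon>))))"
proof (intro conjI)
  show "\<forall>nx ny X Y z0 f D \<epsilon>.
        0 < D \<and> 0 < \<epsilon> \<and> convex_body nx D X \<and> convex_body ny D Y \<and> z0 \<in> X \<times> Y \<and>
        convex_concave (ambient nx ny) (X \<times> Y) f \<longrightarrow>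
        strongly_convex_concave (ambient nx ny) (X \<times> Y) (\<epsilon> / (2 * D\<^sup>2)) (regularized \<epsilon> D z0 f) \<and>
        (\<forall>z. gap_accurate X Y (regularized \<epsilon> D z0 f) (\<epsilon> / 2) z \<longrightarrow> gap_accurate X Y f \<epsilon> z)"
  proof (intro allI impI, elim conjE)
    fix nx ny X Y z0 f and D \<epsilon> :: real
    assume A: "0 < D" "0 < \<epsilon>" "convex_body nx D X" "convex_body ny D Y" "z0 \<in> X \<times> Y"
      "convex_concave (ambient nx ny) (X \<times> Y) f"
    have "X \<times> Y \<subseteq> ambient nx ny" using A(3,4) by (auto simp: convex_body_def ambient_def)
    then show "strongly_convex_concave (ambient nx ny) (X \<times> Y) (\<epsilon> / (2 * D\<^sup>2)) (regularized \<epsilon> D z0 f) \<and>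
        (\<forall>z. gap_accurate X Y (regularized \<epsilon> D z0 f) (\<epsilon> / 2) z \<longrightarrow> gap_accurate X Y f \<epsilon> z)"
      using regularized_strongly_convex_concave[OF A(6) _ A(5)] regularized_gap_accurate[OF A(1-5)] by blast
  qed
  show "\<exists>c>0. \<exists>\<delta>>0. \<forall>L D \<epsilon> \<kappa> :: real.
        0 < L \<and> 0 < D \<and> 0 < \<epsilon> \<and> \<epsilon> \<le> \<delta> * D\<^sup>2 \<and> \<epsilon> \<le> \<delta> * (L * D\<^sup>2) \<and> 1 \<le> \<kappa> \<longrightarrow>
        (\<exists>M E W nx ny X Y fs.
           network M \<kappa> E W \<and>
           convex_body nx D X \<and> convex_body ny D Y \<and> 0 \<in> X \<and> 0 \<in> Y \<and>
           (\<forall>m<M. fs m differentiable_on ambient nx ny) \<and>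
           convex_concave (ambient nx ny) (ambient nx ny) (average M fs) \<and>
           L_smooth (ambient nx ny) (ambient nx ny) L (average M fs) \<and>
           complexity_at_least M (ambient nx ny) X Y fs E \<epsilon>
             (c * (\<kappa> * (L * D\<^sup>2 / \<epsilon>))) (c * (L * D\<^sup>2 / \<epsilon>)) \<and>
           complexity_at_least M (ambient nx ny) X Y (\<lambda>m. regularized \<epsilon> D (0, 0) (fs m)) E (\<epsilon> / 2)
             (c * (\<kappa> * (L * D\<^sup>2 / \<epsilon>))) (c * (L * D\<^sup>2 / \<epsilon>)))"
    \<comment> \<open>With 1/64 for \<open>\<delta>\<close>, \<open>u\<close> is at least 64, which
      absorbs the rounding of \<open>n\<close>, and \<open>32 * \<epsilon>\<close> is at most half
      of \<open>D\<^sup>2\<close>, which gives the strict accuracy condition.\<close>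
    by (rule exI[of _ "1 / 16"], rule conjI, simp, rule exI[of _ "1 / 64"], rule conjI, simp,
        intro allI impI, elim conjE, rule lower_bound_instance)
qed

end
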